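(* Let $\omega\in\mathbb W_d$ be a doubling weight with lower dilation index $i_\omega>0$. Let $\mathcal B$ be a quasi-greedy M-basis of a quasi-Banach space $\mathbb X$. (1) If $\mathcal B$ is semi-greedy, then $\mathcal A_q^\omega\approx\mathcal{CG}_q^\omega$ for all $q\in(0,\infty]$. (2) If $\mathcal B$ is a Schauder basis with Property (W) and $\mathcal A_q^\omega\approx\mathcal{CG}_q^\omega$ for some $q\in(0,\infty]$, then $\mathcal B$ is semi-greedy.
   Context: Spaces and bases. A quasi-Banach space $(\mathbb X,\|\cdot\|)$ over $\mathbb F=\mathbb R$ or $\mathbb C$ is a complete vector space with a quasi-norm: $\|x\|=0$ iff $x=0$; $\|tx\|=|t|\|x\|$; $\|x+y\|\le\kappa(\|x\|+\|y\|)$ for some $\kappa\ge1$. An M-basis (or simply basis) of $\mathbb X$ is a sequence $\mathcal B=(e_n)_{n\ge1}$ for which there are functionals $(e_n^* )\subset\mathbb X^*$ with $e_i^*(e_j)=\delta_{i,j}$; $0<c_1\le\|e_n\|,\|e_n^*\|_*\le c_2<\infty$ for all $n$; $\overline{\mathrm{span}\{e_n\}}=\mathbb X$; and $e_n^*(x)=0$ for all $n$ implies $x=0$. With $S_m(x)=\sum_{n=1}^m e_n^*(x)e_n$, $\mathcal B$ is Schauder if $\sup_m\|S_m\|<\infty$. Errors. Put $\mathrm{supp}(x)=\{n:e_n^*(x)\ne0\}$. A greedy ordering of $x$ is an injective map $\pi:\mathbb N\to\mathbb N$ with $\mathrm{supp}(x)\subset\pi(\mathbb N)$ and $|e^*_{\pi(i)}(x)|\ge|e^*_{\pi(j)}(x)|$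 whenever $i\le j$. For $m\in\mathbb N$, $\sigma_m(x)=\inf\{\|x-\sum_{n\in A}b_ne_n\|:|A|=m,\ b_n\in\mathbb F\}$, $\gamma_m(x)=\sup_\pi\|x-\sum_{n=1}^m e^*_{\pi(n)}(x)e_{\pi(n)}\|$, $\vartheta_m(x)=\sup_\pi\inf_{(a_n)\subset\mathbb F}\|x-\sum_{n=1}^m a_ne_{\pi(n)}\|$, with suprema over greedy orderings $\pi$ of $x$. $\mathcal B$ is quasi-greedy if there is $C>0$ with $\gamma_m(x)\le C\|x\|$ for all $x\in\mathbb X$, $m\in\mathbb N$. $\mathcal B$ is semi-greedy if there is $C>0$ with $\vartheta_m(x)\le C\sigma_m(x)$ for all $x\in\mathbb X$, $m\in\mathbb N$. Weights. $\mathbb W$ is the set of sequences $\omega=(\omega(n))_{n\ge1}$ with $0<\omega(1)\le\omega(2)\le\cdots$ and $\omega(n)\to\infty$. $\mathbb W_d$ (doubling weights) is the set of $\omega\in\mathbb W$ for which there is $\theta\ge1$ with $\omega(2n)\le\theta\,\omega(n)$ for all $n$. For $\omega\in\mathbb W$, $\varphi_\omega(M)=\inf_{k\ge1}\omega(Mk)/\omega(k)$ and $i_\omega=\sup_{M>1}\ln\varphi_\omega(M)/\ln M$ ($M$ ranging over integers). Classes. For $0<q<\infty$, $\|x\|_{\mathcal A_q^\omega}=\|x\|+\big[\sum_{n\ge1}(\omega(n)\sigma_n(x))^q\frac1n\big]^{1/q}$, and $\|x\|_{\mathcal A_\infty^\omega}=\|x\|+\sup_{n\ge1}\omega(n)\sigma_n(x)$;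 $\mathcal A_q^\omega$ is the set of $x\in\mathbb X$ for which this is finite. $\mathcal{CG}_q^\omega$ is defined in the same way with $\vartheta_n$ in place of $\sigma_n$. For two such classes, $X\hookrightarrow Y$ means $X\subset Y$ and there is $C>0$ with $\|x\|_Y\le C\|x\|_X$ for all $x\in X$; $X\approx Y$ means $X\hookrightarrow Y$ and $Y\hookrightarrow X$. Property (W). For finite $A\subset\mathbb N$ and scalars $\varepsilon=(\varepsilon_n)_{n\in A}$ with $|\varepsilon_n|=1$ for all $n$ (written $|\varepsilon|=1$), $1_{\varepsilon A}=\sum_{n\in A}\varepsilon_ne_n$; $h_r(m)=\sup_{|A|\le m,|\varepsilon|=1}\|1_{\varepsilon A}\|$. $\mathcal B$ has Property (W) if there is $C>0$ such that for all $n\in\mathbb N$ and all $m\ge n$ there are $A\subset\{m+1,m+2,\dots\}$ with $|A|=n$ and $|\varepsilon|=1$ such that $h_r(n)\le C\|1_{\varepsilon A}\|$. *)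

theory Defs
  imports "HOL-Analysis.Analysis"
begin

text \<open>
  Scalars. The scalar type is an arbitrary type of sort
  \<open>{real_normed_field, euclidean_space}\<close>. Both \<open>real\<close> and \<open>complex\<close> have this sort, and by the
  Gelfand--Mazur theorem every type of class \<open>real_normed_field\<close> is isometrically isomorphic to
  one of these two.

  Indexing. Basis vectors and greedy orderings are indexed from 0, so that \<open>e n\<close> stands for the
  basis vector with number \<open>n + 1\<close>. Weights \<open>\<omega> n\<close> and the errors of order \<open>n\<close> are indexed by
  the numbers \<open>n \<ge> 1\<close>; the value \<open>\<omega> 0\<close> is never used.
\<close>

type_synonym ('f, 'a) scaling = "'f \<Rightarrow> 'a \<Rightarrow> 'a"

subsection \<open>Quasi-Banach spaces and bases\<close>

text \<open>A topology is not taken from the type: convergence always refers to the quasi-norm \<open>N\<close>.\<close>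

locale quasi_banach_space = vector_space scl
  for scl :: "('f::{real_normed_field, euclidean_space}, 'a::ab_group_add) scaling" +
  fixes N :: "'a \<Rightarrow> real"
  assumes nonneg: "0 \<le> N x"
    and eq_0_iff: "N x = 0 \<longleftrightarrow> x = 0"
    and homogeneous: "N (scl t x) = norm t * N x"
    and quasi_triangle: "\<exists>\<kappa>\<ge>1. \<forall>x y. N (x + y) \<le> \<kappa> * (N x + N y)"
    and complete:
      "(\<And>\<epsilon>. 0 < \<epsilon> \<Longrightarrow> \<exists>K. \<forall>m\<ge>K. \<forall>n\<ge>K. N (u m - u n) < \<epsilon>)
        \<Longrightarrow> \<exists>x. (\<lambda>n. N (u n - x)) \<longlonglongrightarrow> 0"

definition op_norm :: "('a \<Rightarrow> real) \<Rightarrow> ('b \<Rightarrow> real) \<Rightarrow> ('a \<Rightarrow> 'b) \<Rightarrow> ennreal" where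
  "op_norm N N' T = (SUP x\<in>{x. N x \<le> 1}. ennreal (N' (T x)))"

definition dual_space ::
  "('f::{real_normed_field, euclidean_space}, 'a::ab_group_add) scaling \<Rightarrow> ('a \<Rightarrow> real) \<Rightarrow> ('a \<Rightarrow> 'f) set"
  where
  "dual_space scl N = {f. Vector_Spaces.linear scl (*) f \<and> op_norm N norm f < \<infinity>}"

text \<open>The coordinate functionals \<open>es\<close> are uniquely determined by the sequence \<open>e\<close>, because they are
  continuous and the span of \<open>e\<close> is dense.\<close>

locale M_basis = quasi_banach_space scl N
  for scl :: "('f::{real_normed_field, euclidean_space}, 'a::ab_group_add) scaling"
    and N :: "'a \<Rightarrow> real" +
  fixes e :: "nat \<Rightarrow> 'a" and es :: "nat \<Rightarrow> 'a \<Rightarrow> 'f"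
  assumes dual: "es n \<in> dual_space scl N"
    and biorthogonal: "es i (e j) = (if i = j then 1 else 0)"
    and seminormalized:
      "\<exists>c1 c2. 0 < c1 \<and>
        (\<forall>n. c1 \<le> N (e n) \<and> N (e n) \<le> c2 \<and>
             ennreal c1 \<le> op_norm N norm (es n) \<and> op_norm N norm (es n) \<le> ennreal c2)"
    and span_dense: "0 < \<epsilon> \<Longrightarrow> \<exists>y\<in>span (range e). N (x - y) < \<epsilon>"
    and es_total: "(\<And>n. es n x = 0) \<Longrightarrow> x = 0"

definition partial_sum ::
  "('f, 'a::ab_group_add) scaling \<Rightarrow> (nat \<Rightarrow> 'a) \<Rightarrow> (nat \<Rightarrow> 'a \<Rightarrow> 'f) \<Rightarrow> nat \<Rightarrow> 'a \<Rightarrow> 'a" where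
  "partial_sum scl e es m x = (\<Sum>n<m. scl (es n x) (e n))"

definition schauder ::
  "('f, 'a::ab_group_add) scaling \<Rightarrow> ('a \<Rightarrow> real) \<Rightarrow> (nat \<Rightarrow> 'a) \<Rightarrow> (nat \<Rightarrow> 'a \<Rightarrow> 'f) \<Rightarrow> bool" where
  "schauder scl N e es \<longleftrightarrow> (SUP m. op_norm N N (partial_sum scl e es m)) < \<infinity>"


subsection \<open>Approximation errors\<close>

definition supp :: "(nat \<Rightarrow> 'a \<Rightarrow> 'f::zero) \<Rightarrow> 'a \<Rightarrow> nat set" where
  "supp es x = {n. es n x \<noteq> 0}"

definition greedy_orderings :: "(nat \<Rightarrow> 'a \<Rightarrow> 'f::real_normed_field) \<Rightarrow> 'a \<Rightarrow> (nat \<Rightarrow> nat) set" where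
  "greedy_orderings es x =
    {\<pi>. inj \<pi> \<and> supp es x \<subseteq> range \<pi> \<and>
        (\<forall>i j. i \<le> j \<longrightarrow> norm (es (\<pi> j) x) \<le> norm (es (\<pi> i) x))}"

text \<open>For an M-basis all suprema and infima of real numbers below are taken over nonempty
  sets that are bounded on the relevant side: greedy orderings exist because \<open>es n x\<close> tends to 0,
  greedy sums of length \<open>m\<close> are bounded by a multiple (depending on \<open>m\<close>) of \<open>N x\<close>, and
  the inner infimum in \<open>chebyshev_error\<close> is at most \<open>N x\<close>.\<close>

definition best_error ::
  "('f, 'a::ab_group_add) scaling \<Rightarrow> ('a \<Rightarrow> real) \<Rightarrow> (nat \<Rightarrow> 'a) \<Rightarrow> nat \<Rightarrow> 'a \<Rightarrow> real" where
  "best_error scl N e m x =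
    Inf {N (x - (\<Sum>n\<in>A. scl (b n) (e n))) | A b. finite A \<and> card A = m}"

definition greedy_error ::
  "('f::real_normed_field, 'a::ab_group_add) scaling \<Rightarrow> ('a \<Rightarrow> real) \<Rightarrow> (nat \<Rightarrow> 'a) \<Rightarrow>
    (nat \<Rightarrow> 'a \<Rightarrow> 'f) \<Rightarrow> nat \<Rightarrow> 'a \<Rightarrow> real" where
  "greedy_error scl N e es m x =
    (SUP \<pi>\<in>greedy_orderings es x. N (x - (\<Sum>n<m. scl (es (\<pi> n) x) (e (\<pi> n)))))"

definition chebyshev_error ::
  "('f::real_normed_field, 'a::ab_group_add) scaling \<Rightarrow> ('a \<Rightarrow> real) \<Rightarrow> (nat \<Rightarrow> 'a) \<Rightarrow>
    (nat \<Rightarrow> 'a \<Rightarrow> 'f) \<Rightarrow> nat \<Rightarrow> 'a \<Rightarrow> real" where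
  "chebyshev_error scl N e es m x =
    (SUP \<pi>\<in>greedy_orderings es x. INF a. N (x - (\<Sum>n<m. scl (a n) (e (\<pi> n)))))"

definition quasi_greedy ::
  "('f::real_normed_field, 'a::ab_group_add) scaling \<Rightarrow> ('a \<Rightarrow> real) \<Rightarrow> (nat \<Rightarrow> 'a) \<Rightarrow>
    (nat \<Rightarrow> 'a \<Rightarrow> 'f) \<Rightarrow> bool" where
  "quasi_greedy scl N e es \<longleftrightarrow>
    (\<exists>C>0. \<forall>x. \<forall>m\<ge>1. greedy_error scl N e es m x \<le> C * N x)"

definition semi_greedy ::
  "('f::real_normed_field, 'a::ab_group_add) scaling \<Rightarrow> ('a \<Rightarrow> real) \<Rightarrow> (nat \<Rightarrow> 'a) \<Rightarrow>
    (nat \<Rightarrow> 'a \<Rightarrow> 'f) \<Rightarrow> bool" where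
  "semi_greedy scl N e es \<longleftrightarrow>
    (\<exists>C>0. \<forall>x. \<forall>m\<ge>1. chebyshev_error scl N e es m x \<le> C * best_error scl N e m x)"


subsection \<open>Weights\<close>

definition weight :: "(nat \<Rightarrow> real) \<Rightarrow> bool" where
  "weight \<omega> \<longleftrightarrow> 0 < \<omega> 1 \<and> (\<forall>n\<ge>1. \<omega> n \<le> \<omega> (Suc n)) \<and> filterlim \<omega> at_top sequentially"

definition doubling_weight :: "(nat \<Rightarrow> real) \<Rightarrow> bool" where
  "doubling_weight \<omega> \<longleftrightarrow> weight \<omega> \<and> (\<exists>\<theta>\<ge>1. \<forall>n\<ge>1. \<omega> (2 * n) \<le> \<theta> * \<omega> n)"

definition dilation :: "(nat \<Rightarrow> real) \<Rightarrow> nat \<Rightarrow> real" where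
  "dilation \<omega> M = (INF k\<in>{1..}. \<omega> (M * k) / \<omega> k)"

text \<open>Extended real values: for weights that are not doubling the supremum can be infinite.\<close>

definition lower_dilation_index :: "(nat \<Rightarrow> real) \<Rightarrow> ereal" where
  "lower_dilation_index \<omega> = (SUP M\<in>{2..}. ereal (ln (dilation \<omega> M) / ln (real M)))"


subsection \<open>Approximation classes\<close>

text \<open>The class and its quasi-norm for a family of errors \<open>E\<close>, where \<open>E n x\<close> is the error of
  order \<open>n\<close>. The case \<open>q = \<infinity>\<close> is the supremum version; finiteness of the defining expression is
  boundedness, respectively convergence of the series. The quasi-norm is used only on the class.\<close>

definition error_class ::
  "(nat \<Rightarrow> real) \<Rightarrow> ennreal \<Rightarrow> (nat \<Rightarrow> 'a \<Rightarrow> real) \<Rightarrow> 'a set" where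
  "error_class \<omega> q E =
    (if q = \<infinity> then {x. bdd_above ((\<lambda>n. \<omega> n * E n x) ` {1..})}
     else {x. summable (\<lambda>n. (\<omega> (Suc n) * E (Suc n) x) powr enn2real q * (1 / real (Suc n)))})"

definition error_class_norm ::
  "('a \<Rightarrow> real) \<Rightarrow> (nat \<Rightarrow> real) \<Rightarrow> ennreal \<Rightarrow> (nat \<Rightarrow> 'a \<Rightarrow> real) \<Rightarrow> 'a \<Rightarrow> real" where
  "error_class_norm N \<omega> q E x =
    N x + (if q = \<infinity> then (SUP n\<in>{1..}. \<omega> n * E n x)
      else (\<Sum>n. (\<omega> (Suc n) * E (Suc n) x) powr enn2real q * (1 / real (Suc n)))
             powr (1 / enn2real q))"

text \<open>A class is given as a pair of its carrier and its quasi-norm.\<close>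

definition embeds :: "'a set \<times> ('a \<Rightarrow> real) \<Rightarrow> 'a set \<times> ('a \<Rightarrow> real) \<Rightarrow> bool"  (infix \<open>\<hookrightarrow>\<close> 50) where
  "X \<hookrightarrow> Y \<longleftrightarrow> fst X \<subseteq> fst Y \<and> (\<exists>C>0. \<forall>x\<in>fst X. snd Y x \<le> C * snd X x)"

definition class_equiv :: "'a set \<times> ('a \<Rightarrow> real) \<Rightarrow> 'a set \<times> ('a \<Rightarrow> real) \<Rightarrow> bool" where
  "class_equiv X Y \<longleftrightarrow> X \<hookrightarrow> Y \<and> Y \<hookrightarrow> X"

definition approx_class ::
  "('f, 'a::ab_group_add) scaling \<Rightarrow> ('a \<Rightarrow> real) \<Rightarrow> (nat \<Rightarrow> 'a) \<Rightarrow>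
    (nat \<Rightarrow> real) \<Rightarrow> ennreal \<Rightarrow> 'a set \<times> ('a \<Rightarrow> real)" where
  "approx_class scl N e \<omega> q =
    (error_class \<omega> q (best_error scl N e), error_class_norm N \<omega> q (best_error scl N e))"

definition chebyshev_greedy_class ::
  "('f::real_normed_field, 'a::ab_group_add) scaling \<Rightarrow> ('a \<Rightarrow> real) \<Rightarrow> (nat \<Rightarrow> 'a) \<Rightarrow>
    (nat \<Rightarrow> 'a \<Rightarrow> 'f) \<Rightarrow> (nat \<Rightarrow> real) \<Rightarrow> ennreal \<Rightarrow> 'a set \<times> ('a \<Rightarrow> real)" where
  "chebyshev_greedy_class scl N e es \<omega> q =
    (error_class \<omega> q (chebyshev_error scl N e es),
     error_class_norm N \<omega> q (chebyshev_error scl N e es))"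


subsection \<open>Property (W)\<close>

definition unimodular_on :: "nat set \<Rightarrow> (nat \<Rightarrow> 'f::real_normed_field) \<Rightarrow> bool" where
  "unimodular_on A \<epsilon> \<longleftrightarrow> (\<forall>n\<in>A. norm (\<epsilon> n) = 1)"

definition signed_indicator ::
  "('f, 'a::ab_group_add) scaling \<Rightarrow> (nat \<Rightarrow> 'a) \<Rightarrow> (nat \<Rightarrow> 'f) \<Rightarrow> nat set \<Rightarrow> 'a" where
  "signed_indicator scl e \<epsilon> A = (\<Sum>n\<in>A. scl (\<epsilon> n) (e n))"

definition upper_democracy ::
  "('f::real_normed_field, 'a::ab_group_add) scaling \<Rightarrow> ('a \<Rightarrow> real) \<Rightarrow> (nat \<Rightarrow> 'a) \<Rightarrow> nat \<Rightarrow> real" where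
  "upper_democracy scl N e m =
    Sup {N (signed_indicator scl e \<epsilon> A) | A \<epsilon>. finite A \<and> card A \<le> m \<and> unimodular_on A \<epsilon>}"

text \<open>With indices starting at 0, the basis vectors with numbers \<open>m + 1, m + 2, \<dots>\<close> are those
  with indices in \<open>{m..}\<close>.\<close>

definition property_W ::
  "('f::real_normed_field, 'a::ab_group_add) scaling \<Rightarrow> ('a \<Rightarrow> real) \<Rightarrow> (nat \<Rightarrow> 'a) \<Rightarrow> bool" where
  "property_W scl N e \<longleftrightarrow>
    (\<exists>C>0. \<forall>n\<ge>1. \<forall>m\<ge>n. \<exists>A \<epsilon>. A \<subseteq> {m..} \<and> finite A \<and> card A = n \<and> unimodular_on A \<epsilon> \<and>
       upper_democracy scl N e n \<le> C * N (signed_indicator scl e \<epsilon> A))"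

end

theory Submission
  imports Defs
begin

text \<open>
  Part (1) holds because the two errors are equivalent. For part (2), apply the embedding of the
  approximation class to \<open>x = 1\<^sub>A + 1\<^sub>B\<close>, where \<open>B\<close> lies to the right of \<open>A\<close>, is supplied by
  Property (W), and has \<open>\<delta> * card A\<close> elements. A greedy ordering may exhaust \<open>A\<close> first, so the
  Schauder property bounds the first \<open>card A\<close> Chebyshev errors of \<open>x\<close> below by a multiple of
  \<open>N 1\<^sub>B\<close>, while the best errors of \<open>x\<close> drop to \<open>N 1\<^sub>A\<close> after \<open>card B\<close> terms. Since the weight
  grows at a positive power rate, for small \<open>\<delta>\<close> this gives \<open>N 1\<^sub>B \<le> C * N 1\<^sub>A\<close>, hence
  superdemocracy of the basis. Semi-greediness then follows by the truncation argument for
  quasi-greedy bases. As a quasi-norm need not be locally convex, the boundedness of truncation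
  does not follow by Abel summation; instead the coefficients are cut into geometric chunks.
\<close>

section \<open>Quasi-norms\<close>

text \<open>Part (2) is an absorption argument. The quasi-norm of the indicator of \<open>B\<close>
  occurs on both sides of the class inequality, with weight \<open>\<omega> (card A)\<close> on the
  left and \<open>\<omega> (card B)\<close> on the right. Positivity of the lower dilation index
  makes the second weight an arbitrarily small fraction of the first once \<open>B\<close> is a
  small enough fraction of \<open>A\<close>. Shrinking \<open>B\<close> costs only a constant, since
  the upper democracy function grows by a bounded factor when its argument doubles. The same
  positivity bounds the weighted power sums by their last term, so the class norm of a step-shaped
  error profile is controlled by its break points; doubling gives the matching lower estimate.

  In the truncation argument every addition may cost a factor \<open>qc\<close>, so many pieces can
  be added only if they decay faster than \<open>qc\<close> grows. This calls for chunks of ratio at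
  least \<open>2 * qc\<close>, whereas perturbation handles only ratios close to 1. A fixed number
  of narrow chunks is therefore joined into one wide chunk, and wide chunks are then summed as a
  geometric series.\<close>

context quasi_banach_space
begin

text \<open>The locale only asserts that a modulus of concavity exists; fixing one allows explicit
  constants.\<close>

definition qc :: real where
  "qc = (SOME \<kappa>. 1 \<le> \<kappa> \<and> (\<forall>x y. N (x + y) \<le> \<kappa> * (N x + N y)))"

lemma qc_ge_1: "1 \<le> qc" and N_add: "N (x + y) \<le> qc * (N x + N y)"
proof -
  have "1 \<le> qc \<and> (\<forall>x y. N (x + y) \<le> qc * (N x + N y))"
    unfolding qc_def by (rule someI_ex) (use quasi_triangle in blast)
  then show "1 \<le> qc" "N (x + y) \<le> qc * (N x + N y)" by auto
qed

lemma qc_pos: "0 < qc"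
  using qc_ge_1 by simp

lemma N_0 [simp]: "N 0 = 0"
  by (simp add: eq_0_iff)

lemma N_minus [simp]: "N (- x) = N x"
  using homogeneous[of "-1" x] by simp

lemma N_diff: "N (x - y) \<le> qc * (N x + N y)"
  using N_add[of x "- y"] by simp

text \<open>The constant is exponential in the number of terms, so the bound serves for a fixed
  number of summands or for mere finiteness. Uniform estimates come from
  \<open>N_convex_sum\<close>.\<close>

lemma N_sum: "finite A \<Longrightarrow> N (sum f A) \<le> qc ^ card A * (\<Sum>a\<in>A. N (f a))"
proof (induction A rule: finite_induct)
  case (insert a A)
  have "N (f a) \<le> qc ^ card A * N (f a)"
    using mult_right_mono[OF one_le_power[OF qc_ge_1, of "card A"] nonneg[of "f a"]] by simp
  then have "N (f a) + N (sum f A) \<le> qc ^ card A * (\<Sum>a\<in>insert a A. N (f a))"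
    using insert by (simp add: distrib_left)
  then have "qc * (N (f a) + N (sum f A)) \<le> qc * (qc ^ card A * (\<Sum>a\<in>insert a A. N (f a)))"
    using qc_pos by (simp add: mult_left_mono)
  then show ?case
    using insert N_add[of "f a" "sum f A"] by (simp add: mult.assoc)
qed simp

lemma N_sum_le:
  assumes "finite A" "\<And>a. a \<in> A \<Longrightarrow> N (f a) \<le> s"
  shows "N (sum f A) \<le> qc ^ card A * (real (card A) * s)"
proof -
  have "(\<Sum>a\<in>A. N (f a)) \<le> real (card A) * s"
    using sum_bounded_above[of A "\<lambda>a. N (f a)" s] assms by simp
  then show ?thesis
    using N_sum[OF assms(1), of f] qc_pos
    by (meson mult_left_mono order_trans zero_le_power less_imp_le)
qed

text \<open>A quasi-norm ball is not convex. Peeling off one digit in a base \<open>b \<ge> 2 * qc\<close> bounds the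
  supremum over all coefficients by a multiple of \<open>S\<close> plus half of itself.\<close>

lemma N_convex_sum:
  "\<exists>C>0. \<forall>F (g :: 'i \<Rightarrow> 'a) c S. finite F \<longrightarrow> (\<forall>n\<in>F. 0 \<le> c n \<and> c n \<le> (1::real)) \<longrightarrow>
     (\<forall>B\<subseteq>F. N (sum g B) \<le> S) \<longrightarrow> N (\<Sum>n\<in>F. scl (of_real (c n)) (g n)) \<le> C * S"
proof -
  obtain b :: nat where b: "2 * qc \<le> real b" using real_arch_simple by blast
  have b0: "0 < real b" using b qc_pos by linarith
  have "N (\<Sum>n\<in>F. scl (of_real (c n)) (g n)) \<le> 2 * qc ^ Suc b * S"
    if F: "finite F" and c: "\<forall>n\<in>F. 0 \<le> c n \<and> c n \<le> (1::real)" and S: "\<forall>B\<subseteq>F. N (sum g B) \<le> S"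
    for F and g :: "'i \<Rightarrow> 'a" and c S
  proof -
    define V where "V = (\<lambda>c. \<Sum>n\<in>F. scl (of_real (c n)) (g n))"
    define U where "U = {c :: 'i \<Rightarrow> real. \<forall>n\<in>F. 0 \<le> c n \<and> c n \<le> 1}"
    define K where "K = (SUP c\<in>U. N (V c))"
    \<comment> \<open>This crude bound depends on \<open>F\<close> and \<open>g\<close>, but it
      makes the supremum \<open>K\<close> finite, without which \<open>K / 2\<close> could not be
      absorbed.\<close>
    have "N (V c) \<le> qc ^ card F * (\<Sum>n\<in>F. N (g n))" if "c \<in> U" for c
    proof -
      have "N (V c) \<le> qc ^ card F * (\<Sum>n\<in>F. N (scl (of_real (c n)) (g n)))"
        unfolding V_def by (rule N_sum[OF F])
      also have "\<dots> \<le> qc ^ card F * (\<Sum>n\<in>F. N (g n))"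
        using that qc_pos nonneg
        by (intro mult_left_mono sum_mono) (auto simp: U_def homogeneous mult_left_le_one_le)
      finally show ?thesis .
    qed
    then have bdd: "bdd_above ((\<lambda>c. N (V c)) ` U)" by (auto intro!: bdd_aboveI)
    have K: "N (V c) \<le> K" if "c \<in> U" for c
      unfolding K_def using bdd that by (rule cSUP_upper2) simp
    have step: "N (V c) \<le> qc ^ Suc b * S + K / 2" if cU: "c \<in> U" for c
    proof -
      \<comment> \<open>\<open>d n\<close> is the leading digit of \<open>c n\<close> in base
        \<open>b\<close>, with value \<open>b\<close> at \<open>c n = 1\<close>. The remainders
        \<open>c'\<close> again lie in \<open>U\<close>, so \<open>K\<close> bounds their
        sum.\<close>
      define d where "d = (\<lambda>n. nat \<lfloor>real b * c n\<rfloor>)"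
      define c' where "c' = (\<lambda>n. real b * c n - real (d n))"
      have d: "d n \<le> b" "real (d n) = of_int \<lfloor>real b * c n\<rfloor>" if "n \<in> F" for n
      proof -
        have "0 \<le> c n" "c n \<le> 1" using cU that by (auto simp: U_def)
        then have "0 \<le> real b * c n" "real b * c n \<le> real b"
          by (auto simp: mult_left_le)
        then show "d n \<le> b" "real (d n) = of_int \<lfloor>real b * c n\<rfloor>"
          unfolding d_def by (auto simp: le_floor_iff floor_le_iff nat_le_iff)
      qed
      have c'U: "c' \<in> U"
        unfolding U_def c'_def using d(2) by (auto simp: algebra_simps) linarith+
      \<comment> \<open>Layer-cake formula: \<open>d n\<close> counts the levels
        \<open>j < d n\<close>, so the digit part is a sum of \<open>b\<close> subset sums, each
        bounded by \<open>S\<close>.\<close>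
      have digit: "scl (of_nat (d n)) (g n) = (\<Sum>j<b. if j < d n then g n else 0)" if "n \<in> F" for n
      proof -
        have "(\<Sum>j<b. if j < d n then g n else 0) = (\<Sum>j\<in>{..<b} \<inter> {j. j < d n}. g n)"
          by (simp add: sum.If_cases)
        also have "{..<b} \<inter> {j. j < d n} = {..<d n}" using d(1)[OF that] by auto
        also have "(\<Sum>j<d n. g n) = scl (of_nat (d n)) (g n)"
          by (simp add: sum_constant_scale)
        finally show ?thesis by simp
      qed
      have "V c = scl (of_real (1 / real b))
          ((\<Sum>j<b. sum g {n\<in>F. j < d n}) + V c')"
      proof -
        have "(\<Sum>j<b. sum g {n\<in>F. j < d n}) = (\<Sum>j<b. \<Sum>n\<in>F. if j < d n then g n else 0)"
          using F by (simp add: sum.inter_filter)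
        also have "\<dots> = (\<Sum>n\<in>F. scl (of_nat (d n)) (g n))"
          by (subst sum.swap) (simp add: digit)
        finally have "(\<Sum>j<b. sum g {n\<in>F. j < d n}) + V c' =
            (\<Sum>n\<in>F. scl (of_real (real b * c n)) (g n))"
          unfolding V_def
          by (simp flip: sum.distrib scale_left_distrib add: c'_def)
        then show ?thesis
          using b0 by (simp add: V_def scale_sum_right)
      qed
      then have "N (V c) = (1 / real b) * N ((\<Sum>j<b. sum g {n\<in>F. j < d n}) + V c')"
        using b0 by (simp add: homogeneous norm_divide)
      also have "\<dots> \<le> (1 / real b) * (qc * (qc ^ b * (real b * S) + K))"
      proof (intro mult_left_mono order_trans[OF N_add] add_mono K c'U)
        show "N (\<Sum>j<b. sum g {n\<in>F. j < d n}) \<le> qc ^ b * (real b * S)"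
          using N_sum_le[of "{..<b}" "\<lambda>j. sum g {n\<in>F. j < d n}" S] S by auto
      qed (use qc_pos b0 in auto)
      also have "\<dots> = qc ^ Suc b * S + (qc / real b) * K"
        using b0 by (simp add: field_simps)
      also have "\<dots> \<le> qc ^ Suc b * S + (1 / 2) * K"
      proof (intro add_left_mono mult_right_mono)
        show "qc / real b \<le> 1 / 2" using b b0 by (simp add: field_simps)
        show "0 \<le> K" using K[OF cU] nonneg order_trans by blast
      qed
      finally show ?thesis by simp
    qed
    have cU: "c \<in> U" using c by (simp add: U_def)
    have "K \<le> qc ^ Suc b * S + K / 2"
      unfolding K_def using cU step by (intro cSUP_least) (auto simp: K_def)
    then have "K \<le> 2 * qc ^ Suc b * S" by simp
    then show ?thesis using K[OF cU] by (simp add: V_def)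
  qed
  moreover have "0 < 2 * qc ^ Suc b" using qc_pos by simp
  ultimately show ?thesis by blast
qed

end


section \<open>Greedy orderings\<close>

text \<open>Maxima exist because positive level sets of a null sequence are finite. The last
  conclusion gives control over ties: any prescribed greedy set can be enumerated first.\<close>

lemma greedy_enumeration_exists:
  fixes a :: "nat \<Rightarrow> real"
  assumes nonneg: "\<And>n. 0 \<le> a n" and lim: "a \<longlonglongrightarrow> 0"
    and A: "finite A" "\<And>n k. n \<in> A \<Longrightarrow> k \<notin> A \<Longrightarrow> a k \<le> a n"
  shows "\<exists>\<pi>. inj \<pi> \<and> {n. a n \<noteq> 0} \<subseteq> range \<pi> \<and> (\<forall>i j. i \<le> j \<longrightarrow> a (\<pi> j) \<le> a (\<pi> i)) \<and>
    \<pi> ` {..<card A} = A"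
proof -
  have fin: "finite {n. t \<le> a n}" if "0 < t" for t
  proof -
    have "\<forall>\<^sub>F n in sequentially. a n < t" using lim that by (rule order_tendstoD)
    then obtain M where "\<And>n. M \<le> n \<Longrightarrow> a n < t" by (auto simp: eventually_sequentially)
    then have "{n. t \<le> a n} \<subseteq> {..<M}" by (metis (mono_tags) lessThan_iff linorder_not_less mem_Collect_eq subsetI)
    then show ?thesis by (rule finite_subset) simp
  qed
  \<comment> \<open>A maximal index outside \<open>F\<close> exists while a positive value remains;
    afterwards any fresh index serves. The last clause gives \<open>A\<close> priority.\<close>
  have "\<exists>k. k \<notin> F \<and> (\<forall>j. j \<notin> F \<longrightarrow> a j \<le> a k) \<and> (A - F \<noteq> {} \<longrightarrow> k \<in> A)" if F: "finite F" for F
  proof (cases "A - F = {}")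
    case False
    have "Max (a ` (A - F)) \<in> a ` (A - F)" using A(1) False by (intro Max_in) auto
    then obtain k where k: "k \<in> A - F" "a k = Max (a ` (A - F))" by auto
    have "a j \<le> a k" if "j \<notin> F" for j
    proof (cases "j \<in> A")
      case True
      then show ?thesis unfolding k(2) using that A(1) by (intro Max_ge) auto
    qed (use k(1) A(2) in blast)
    then show ?thesis using k by blast
  next
    case AF: True
    show ?thesis
    proof (cases "\<exists>j. j \<notin> F \<and> 0 < a j")
      case True
      then obtain j where j: "j \<notin> F" "0 < a j" by blast
      define G where "G = {n. a j \<le> a n} - F"
      have G: "finite G" "G \<noteq> {}" using fin[OF j(2)] j by (auto simp: G_def)
      have "Max (a ` G) \<in> a ` G" using G by (intro Max_in) auto
      then obtain k where k: "k \<in> G" "a k = Max (a ` G)" by auto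
      have "a i \<le> a k" if "i \<notin> F" for i
      proof (cases "i \<in> G")
        case True then show ?thesis using k G by simp
      next
        case False
        then have "a i \<le> a j" using that by (simp add: G_def)
        also have "a j \<le> a k" using k by (simp add: G_def)
        finally show ?thesis .
      qed
      then show ?thesis using k AF by (auto simp: G_def)
    next
      case False
      then have "\<forall>j. j \<notin> F \<longrightarrow> a j = 0" using nonneg by (metis less_eq_real_def)
      moreover obtain k where "k \<notin> F" using F ex_new_if_finite infinite_UNIV_nat by blast
      ultimately show ?thesis using AF by (intro exI[of _ k]) auto
    qed
  qed
  then obtain pick where pick: "\<And>F. finite F \<Longrightarrow> pick F \<notin> F"
    "\<And>F j. finite F \<Longrightarrow> j \<notin> F \<Longrightarrow> a j \<le> a (pick F)"
    "\<And>F. finite F \<Longrightarrow> A - F \<noteq> {} \<Longrightarrow> pick F \<in> A" by metis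
  define F where "F = rec_nat {} (\<lambda>_ X. insert (pick X) X)"
  define \<pi> where "\<pi> = (\<lambda>n. pick (F n))"
  have F_Suc: "F (Suc n) = insert (\<pi> n) (F n)" for n by (simp add: F_def \<pi>_def)
  have F: "F n = \<pi> ` {..<n}" for n
  proof (induction n)
    case 0 show ?case by (simp add: F_def)
  qed (simp add: F_Suc lessThan_Suc)
  have \<pi>: "\<pi> n = pick (\<pi> ` {..<n})" for n unfolding F[symmetric] by (simp add: \<pi>_def)
  have new: "\<pi> j \<noteq> \<pi> i" if "i < j" for i j
    using pick(1)[of "\<pi> ` {..<j}"] that unfolding \<pi>[of j, symmetric] by auto
  then have inj: "inj \<pi>" by (metis injI linorder_neqE_nat)
  have dec: "a j \<le> a (\<pi> n)" if "j \<notin> \<pi> ` {..<n}" for j n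
    using pick(2)[of "\<pi> ` {..<n}" j] that unfolding \<pi>[of n, symmetric] by simp
  have mono: "a (\<pi> j) \<le> a (\<pi> i)" if "i \<le> j" for i j
    using that by (intro dec) (auto simp: inj_eq[OF inj])
  \<comment> \<open>A missed index of positive value would be dominated by every chosen one, which
    puts infinitely many indices into one level set.\<close>
  have supp: "{n. a n \<noteq> 0} \<subseteq> range \<pi>"
  proof (rule subsetI, rule ccontr)
    fix n assume n: "n \<in> {n. a n \<noteq> 0}" "n \<notin> range \<pi>"
    then have "0 < a n" using nonneg[of n] by simp
    moreover have "range \<pi> \<subseteq> {k. a n \<le> a k}" using dec n(2) by auto
    ultimately show False using fin range_inj_infinite[OF inj] finite_subset by blast
  qed
  have inA: "\<pi> i \<in> A" if "i < card A" for i
  proof -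
    have "card (\<pi> ` {..<i}) < card A"
      using that card_image[OF inj_on_subset[OF inj]] by simp
    then have "A - \<pi> ` {..<i} \<noteq> {}"
      by (metis Diff_eq_empty_iff card_mono finite_imageI finite_lessThan not_less)
    then show ?thesis unfolding \<pi>[of i] by (intro pick(3)) simp_all
  qed
  have "\<pi> ` {..<card A} = A"
    using inA A(1) card_image[OF inj_on_subset[OF inj]] by (intro card_subset_eq) auto
  then show ?thesis using inj mono supp by blast
qed

section \<open>Elementary estimates for M-bases\<close>

context M_basis
begin

lemma linear_es: "Vector_Spaces.linear scl (*) (es n)"
  using dual[of n] by (simp add: dual_space_def)

lemma es_add [simp]: "es n (x + y) = es n x + es n y"
  using linear_es[of n] by (simp add: Vector_Spaces.linear_iff)

lemma es_scl [simp]: "es n (scl t x) = t * es n x"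
  using linear_es[of n] by (simp add: Vector_Spaces.linear_iff)

lemma es_0 [simp]: "es n 0 = 0"
  using es_scl[of n 0 0] by simp

lemma es_minus [simp]: "es n (- x) = - es n x"
  using es_scl[of n "-1" x] by simp

lemma es_diff [simp]: "es n (x - y) = es n x - es n y"
  using es_add[of n x "- y"] by simp

lemma es_sum [simp]: "es n (sum f A) = (\<Sum>i\<in>A. es n (f i))"
  by (induction A rule: infinite_finite_induct) auto

lemma es_lincomb: "finite A \<Longrightarrow> es n (\<Sum>i\<in>A. scl (b i) (e i)) = (if n \<in> A then b n else 0)"
  by (simp add: biorthogonal if_distrib cong: if_cong)

lemma e_bound: "\<exists>c>0. \<forall>n. N (e n) \<le> c"
  using seminormalized by (meson less_le_trans order_trans)

lemma es_bound: "\<exists>c>0. \<forall>n x. norm (es n x) \<le> c * N x"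
proof -
  obtain c1 c2 where c: "0 < c1" "\<And>n. c1 \<le> N (e n)" "\<And>n. N (e n) \<le> c2"
    "\<And>n. op_norm N norm (es n) \<le> ennreal c2"
    using seminormalized by blast
  have c2: "0 < c2" using c(1) c(2)[of 0] c(3)[of 0] by linarith
  have "norm (es n x) \<le> c2 * N x" for n x
  proof (cases "x = 0")
    case False
    then have Nx: "0 < N x" using nonneg[of x] eq_0_iff[of x] by linarith
    define y where "y = scl (of_real (1 / N x)) x"
    have "N y \<le> 1" using Nx by (simp add: y_def homogeneous norm_divide)
    then have "ennreal (norm (es n y)) \<le> op_norm N norm (es n)"
      unfolding op_norm_def by (intro SUP_upper2[of y]) auto
    also have "\<dots> \<le> ennreal c2" by (rule c(4))
    finally have "norm (es n y) \<le> c2" using c2 by (simp add: ennreal_le_iff)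
    then show ?thesis using Nx by (simp add: y_def norm_mult norm_divide field_simps)
  qed simp
  then show ?thesis using c2 by blast
qed

text \<open>True for finitely supported vectors; density and the uniform bound on the functionals
  extend it to all \<open>x\<close>.\<close>

lemma es_tendsto_0: "(\<lambda>n. norm (es n x)) \<longlonglongrightarrow> 0"
proof (rule LIMSEQ_I)
  fix \<epsilon> :: real assume \<epsilon>: "0 < \<epsilon>"
  obtain c where c: "0 < c" "\<And>n x. norm (es n x) \<le> c * N x" using es_bound by blast
  obtain y where y: "y \<in> span (range e)" "N (x - y) < \<epsilon> / c"
    using span_dense[of "\<epsilon> / c" x] c(1) \<epsilon> by auto
  have "finite {n. es n y \<noteq> 0}"
    using y(1)
  proof (induction rule: span_induct_alt)
    case base then show ?case by simp
  next
    case (step t v w)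
    then obtain j where "v = e j" by auto
    then have "{n. es n (scl t v + w) \<noteq> 0} \<subseteq> insert j {n. es n w \<noteq> 0}"
      by (auto simp: biorthogonal split: if_splits)
    then show ?case using step finite_subset by blast
  qed
  then obtain M where M: "\<And>n. es n y \<noteq> 0 \<Longrightarrow> n < M"
    using finite_nat_set_iff_bounded by (metis (mono_tags) mem_Collect_eq)
  have "norm (es n x) < \<epsilon>" if "M \<le> n" for n
  proof -
    have "es n y = 0" using M that by (meson not_less)
    then have "norm (es n x) = norm (es n (x - y))" by simp
    also have "\<dots> \<le> c * N (x - y)" by (rule c)
    also have "\<dots> < \<epsilon>" using y(2) c(1) by (simp add: field_simps)
    finally show ?thesis .
  qed
  then show "\<exists>M. \<forall>n\<ge>M. norm (norm (es n x) - 0) < \<epsilon>" by auto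
qed

lemma finite_level_set:
  assumes "0 < t" shows "finite {n. t \<le> norm (es n x)}"
proof -
  have "\<forall>\<^sub>F n in sequentially. norm (es n x) < t"
    using es_tendsto_0 assms by (rule order_tendstoD)
  then obtain M where "\<And>n. M \<le> n \<Longrightarrow> norm (es n x) < t" by (auto simp: eventually_sequentially)
  then have "{n. t \<le> norm (es n x)} \<subseteq> {..<M}"
    by (metis (mono_tags) lessThan_iff linorder_not_less mem_Collect_eq subsetI)
  then show ?thesis by (rule finite_subset) simp
qed

lemma greedy_ordering_of_greedy_set:
  assumes "finite A" "\<And>n k. n \<in> A \<Longrightarrow> k \<notin> A \<Longrightarrow> norm (es k x) \<le> norm (es n x)"
  obtains \<pi> where "\<pi> \<in> greedy_orderings es x" "\<pi> ` {..<card A} = A"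
  using greedy_enumeration_exists[of "\<lambda>n. norm (es n x)" A] es_tendsto_0 assms that
  unfolding greedy_orderings_def supp_def by auto

lemma greedy_orderings_nonempty: "greedy_orderings es x \<noteq> {}"
  using greedy_ordering_of_greedy_set[of "{}" x] by auto

section \<open>Chebyshev and best approximation errors\<close>

lemma chebyshev_inner_bounds:
  shows "bdd_below (range (\<lambda>a. N (x - (\<Sum>n<m. scl (a n) (e (\<pi> n))))))"
    and "0 \<le> (INF a. N (x - (\<Sum>n<m. scl (a n) (e (\<pi> n)))))"
    and "(INF a. N (x - (\<Sum>n<m. scl (a n) (e (\<pi> n))))) \<le> N (x - (\<Sum>n<m. scl (a n) (e (\<pi> n))))"
proof -
  show bdd: "bdd_below (range (\<lambda>a. N (x - (\<Sum>n<m. scl (a n) (e (\<pi> n))))))"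
    using nonneg by (intro bdd_belowI[of _ 0]) auto
  show "0 \<le> (INF a. N (x - (\<Sum>n<m. scl (a n) (e (\<pi> n)))))"
    by (intro cINF_greatest nonneg) simp
  show "(INF a. N (x - (\<Sum>n<m. scl (a n) (e (\<pi> n))))) \<le> N (x - (\<Sum>n<m. scl (a n) (e (\<pi> n))))"
    by (rule cINF_lower[OF bdd]) simp
qed

lemma chebyshev_inner_le_chebyshev_error:
  assumes "\<pi> \<in> greedy_orderings es x"
  shows "(INF a. N (x - (\<Sum>n<m. scl (a n) (e (\<pi> n))))) \<le> chebyshev_error scl N e es m x"
  unfolding chebyshev_error_def
proof (rule cSUP_upper[OF assms bdd_aboveI[of _ "N x"]])
  fix y assume "y \<in> (\<lambda>\<pi>. INF a. N (x - (\<Sum>n<m. scl (a n) (e (\<pi> n))))) ` greedy_orderings es x"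
  then obtain \<pi> where "y = (INF a. N (x - (\<Sum>n<m. scl (a n) (e (\<pi> n)))))" by blast
  then show "y \<le> N x" using chebyshev_inner_bounds(3)[where a = "\<lambda>_. 0"] by simp
qed

lemma chebyshev_error_nonneg: "0 \<le> chebyshev_error scl N e es m x"
proof -
  obtain \<pi> where "\<pi> \<in> greedy_orderings es x" using greedy_orderings_nonempty by blast
  then show ?thesis
    by (rule order_trans[OF chebyshev_inner_bounds(2) chebyshev_inner_le_chebyshev_error])
qed

lemma best_error_nonneg: "0 \<le> best_error scl N e m x"
  unfolding best_error_def
proof (rule cInf_greatest)
  have "finite {..<m} \<and> card {..<m} = m" by simp
  then show "{N (x - (\<Sum>n\<in>A. scl (b n) (e n))) |A b. finite A \<and> card A = m} \<noteq> {}" by blast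
qed (use nonneg in auto)

lemma best_error_le:
  assumes "finite A" "card A = m"
  shows "best_error scl N e m x \<le> N (x - (\<Sum>n\<in>A. scl (b n) (e n)))"
  unfolding best_error_def
  by (rule cInf_lower) (use assms nonneg in \<open>auto intro!: bdd_belowI[of _ 0]\<close>)

lemma best_error_greatest:
  assumes "\<And>A b. finite A \<Longrightarrow> card A = m \<Longrightarrow> y \<le> N (x - (\<Sum>n\<in>A. scl (b n) (e n)))"
  shows "y \<le> best_error scl N e m x"
  unfolding best_error_def
proof (rule cInf_greatest)
  have "finite {..<m} \<and> card {..<m} = m" by simp
  then show "{N (x - (\<Sum>n\<in>A. scl (b n) (e n))) |A b. finite A \<and> card A = m} \<noteq> {}" by blast
qed (use assms in auto)

text \<open>The definition demands exactly \<open>m\<close> indices; fresh indices with coefficient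
  0 fill up a smaller set.\<close>

lemma best_error_le_subset:
  assumes "finite A" "card A \<le> m"
  shows "best_error scl N e m x \<le> N (x - (\<Sum>n\<in>A. scl (b n) (e n)))"
proof -
  have "infinite (- A)" using assms(1) by (simp add: finite_compl)
  then obtain D where D: "finite D" "card D = m - card A" "D \<subseteq> - A"
    using infinite_arbitrarily_large by blast
  define B where "B = A \<union> D"
  have B: "finite B" "A \<subseteq> B" "card B = m"
    using D assms card_Un_disjoint[of A D] by (auto simp: B_def)
  have "(\<Sum>n\<in>B. scl (if n \<in> A then b n else 0) (e n)) = (\<Sum>n\<in>A. scl (b n) (e n))"
    using B by (intro sum.mono_neutral_cong_right) auto
  then show ?thesis using best_error_le[of B m x "\<lambda>n. if n \<in> A then b n else 0"] B by simp
qed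

lemma best_error_le_chebyshev_error: "best_error scl N e m x \<le> chebyshev_error scl N e es m x"
proof -
  obtain \<pi> where \<pi>: "\<pi> \<in> greedy_orderings es x" using greedy_orderings_nonempty by blast
  then have inj: "inj \<pi>" by (simp add: greedy_orderings_def)
  have "best_error scl N e m x \<le> (INF a. N (x - (\<Sum>n<m. scl (a n) (e (\<pi> n)))))"
  proof (rule cINF_greatest)
    fix a :: "nat \<Rightarrow> 'f"
    have "(\<Sum>n\<in>\<pi> ` {..<m}. scl (a (inv \<pi> n)) (e n)) = (\<Sum>n<m. scl (a n) (e (\<pi> n)))"
      using inj by (subst sum.reindex) (auto intro: inj_on_subset)
    then show "best_error scl N e m x \<le> N (x - (\<Sum>n<m. scl (a n) (e (\<pi> n))))"
      using best_error_le[of "\<pi> ` {..<m}" m x "\<lambda>n. a (inv \<pi> n)"] inj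
      by (simp add: card_image inj_on_subset)
  qed simp
  then show ?thesis using chebyshev_inner_le_chebyshev_error[OF \<pi>] order_trans by blast
qed

section \<open>The upper democracy function\<close>

lemma upper_democracy_bdd:
  "bdd_above {N (signed_indicator scl e \<epsilon> A) |A \<epsilon>. finite A \<and> card A \<le> m \<and> unimodular_on A \<epsilon>}"
proof -
  obtain c where c: "0 < c" "\<And>n. N (e n) \<le> c" using e_bound by blast
  have "N (signed_indicator scl e \<epsilon> A) \<le> qc ^ m * (real m * c)"
    if "finite A" "card A \<le> m" "unimodular_on A \<epsilon>" for A \<epsilon>
  proof -
    have "N (signed_indicator scl e \<epsilon> A) \<le> qc ^ card A * (real (card A) * c)"
      unfolding signed_indicator_def
      by (rule N_sum_le) (use that c in \<open>auto simp: homogeneous unimodular_on_def\<close>)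
    also have "\<dots> \<le> qc ^ m * (real m * c)"
      using that c qc_ge_1 by (intro mult_mono power_increasing) auto
    finally show ?thesis .
  qed
  then show ?thesis by (auto intro!: bdd_aboveI)
qed

lemma signed_indicator_le_upper_democracy:
  assumes "finite A" "card A \<le> m" "unimodular_on A \<epsilon>"
  shows "N (signed_indicator scl e \<epsilon> A) \<le> upper_democracy scl N e m"
  unfolding upper_democracy_def by (rule cSup_upper[OF _ upper_democracy_bdd]) (use assms in blast)

lemma upper_democracy_least:
  assumes "\<And>A \<epsilon>. finite A \<Longrightarrow> card A \<le> m \<Longrightarrow> unimodular_on A \<epsilon> \<Longrightarrow>
    N (signed_indicator scl e \<epsilon> A) \<le> y"
  shows "upper_democracy scl N e m \<le> y"
  unfolding upper_democracy_def
proof (rule cSup_least)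
  have "finite {} \<and> card {} \<le> m \<and> unimodular_on {} (\<lambda>_. 1 :: 'f)"
    by (simp add: unimodular_on_def)
  then show "{N (signed_indicator scl e \<epsilon> A) |A \<epsilon>.
      finite A \<and> card A \<le> m \<and> unimodular_on A \<epsilon>} \<noteq> {}" by blast
qed (use assms in auto)

lemma upper_democracy_mono: "m \<le> n \<Longrightarrow> upper_democracy scl N e m \<le> upper_democracy scl N e n"
  by (intro upper_democracy_least signed_indicator_le_upper_democracy) auto

text \<open>Cut the set into two halves. This growth bound later pays for taking \<open>B\<close>
  much smaller than \<open>A\<close>.\<close>

lemma upper_democracy_double:
  "upper_democracy scl N e (2 * m) \<le> 2 * qc * upper_democracy scl N e m"
proof (rule upper_democracy_least)
  fix A and \<epsilon> :: "nat \<Rightarrow> 'f"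
  assume A: "finite A" "card A \<le> 2 * m" and \<epsilon>: "unimodular_on A \<epsilon>"
  obtain B where B: "B \<subseteq> A" "card B = card A div 2"
    using obtain_subset_with_card_n[of "card A div 2" A] by auto
  then have fin: "finite B" "card (A - B) = card A - card A div 2"
    using A finite_subset[OF B(1)] by (auto simp: card_Diff_subset)
  have eq: "signed_indicator scl e \<epsilon> A = signed_indicator scl e \<epsilon> B + signed_indicator scl e \<epsilon> (A - B)"
    unfolding signed_indicator_def using sum.subset_diff[OF B(1) A(1)] by (simp add: add.commute)
  have "unimodular_on B \<epsilon>" "unimodular_on (A - B) \<epsilon>" using \<epsilon> B(1) by (auto simp: unimodular_on_def)
  then have "N (signed_indicator scl e \<epsilon> B) \<le> upper_democracy scl N e m"
    "N (signed_indicator scl e \<epsilon> (A - B)) \<le> upper_democracy scl N e m"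
    using A B(2) fin by (auto intro!: signed_indicator_le_upper_democracy)
  then have "N (signed_indicator scl e \<epsilon> A) \<le> qc * (upper_democracy scl N e m + upper_democracy scl N e m)"
    unfolding eq using N_add qc_pos by (meson add_mono mult_left_mono order_trans less_imp_le)
  then show "N (signed_indicator scl e \<epsilon> A) \<le> 2 * qc * upper_democracy scl N e m"
    by (simp add: algebra_simps)
qed

lemma upper_democracy_pow2:
  "upper_democracy scl N e (2 ^ i * m) \<le> (2 * qc) ^ i * upper_democracy scl N e m"
proof (induction i)
  case (Suc i)
  have "upper_democracy scl N e (2 ^ Suc i * m) \<le> 2 * qc * upper_democracy scl N e (2 ^ i * m)"
    using upper_democracy_double[of "2 ^ i * m"] by (simp add: mult.assoc)
  also have "\<dots> \<le> 2 * qc * ((2 * qc) ^ i * upper_democracy scl N e m)"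
    using Suc qc_pos by (intro mult_left_mono) auto
  finally show ?case by (simp add: mult.assoc)
qed simp

text \<open>Each coefficient factors as \<open>t\<close> times a modulus in [0, 1] times a
  unimodular sign; \<open>N_convex_sum\<close> removes the moduli.\<close>

lemma bounded_lincomb_le_upper_democracy:
  "\<exists>C>0. \<forall>F c t. finite F \<longrightarrow> (\<forall>n\<in>F. norm (c n) \<le> t) \<longrightarrow> 0 < t \<longrightarrow>
    N (\<Sum>n\<in>F. scl (c n) (e n)) \<le> C * t * upper_democracy scl N e (card F)"
proof -
  obtain C where C: "0 < C"
    "\<And>F (g :: nat \<Rightarrow> 'a) c S. finite F \<Longrightarrow> (\<forall>n\<in>F. 0 \<le> c n \<and> c n \<le> (1::real)) \<Longrightarrow>
     (\<forall>B\<subseteq>F. N (sum g B) \<le> S) \<Longrightarrow> N (\<Sum>n\<in>F. scl (of_real (c n)) (g n)) \<le> C * S"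
    using N_convex_sum[where 'i = nat] by blast
  have "N (\<Sum>n\<in>F. scl (c n) (e n)) \<le> C * t * upper_democracy scl N e (card F)"
    if F: "finite F" and c: "\<forall>n\<in>F. norm (c n) \<le> t" and t: "0 < t" for F c t
  proof -
    \<comment> \<open>The value 1 at vanishing coefficients keeps the sign unimodular, since
      \<open>sgn 0 = 0\<close>.\<close>
    define \<epsilon> where "\<epsilon> = (\<lambda>n. if c n = 0 then 1 else sgn (c n))"
    define r where "r = (\<lambda>n. norm (c n) / t)"
    have \<epsilon>: "norm (\<epsilon> n) = 1" for n by (simp add: \<epsilon>_def norm_sgn)
    have c_eq: "c n = of_real t * (of_real (r n) * \<epsilon> n)" for n
      using t by (simp add: r_def \<epsilon>_def sgn_div_norm scaleR_conv_of_real)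
    have "N (\<Sum>n\<in>F. scl (of_real (r n)) (scl (\<epsilon> n) (e n))) \<le> C * upper_democracy scl N e (card F)"
    proof (rule C(2)[OF F])
      show "\<forall>B\<subseteq>F. N (\<Sum>n\<in>B. scl (\<epsilon> n) (e n)) \<le> upper_democracy scl N e (card F)"
        using F \<epsilon> signed_indicator_le_upper_democracy[unfolded signed_indicator_def]
        by (auto simp: unimodular_on_def card_mono finite_subset)
    qed (use c t in \<open>auto simp: r_def\<close>)
    moreover have "(\<Sum>n\<in>F. scl (c n) (e n)) =
        scl (of_real t) (\<Sum>n\<in>F. scl (of_real (r n)) (scl (\<epsilon> n) (e n)))"
      by (simp add: scale_sum_right c_eq)
    ultimately show ?thesis using t by (simp add: homogeneous mult.assoc mult.left_commute)
  qed
  then show ?thesis using C(1) by blast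
qed

end

section \<open>Truncation for quasi-greedy bases\<close>

locale quasi_greedy_basis = M_basis scl N e es
  for scl :: "('f::{real_normed_field, euclidean_space}, 'a::ab_group_add) scaling"
    and N :: "'a \<Rightarrow> real" and e :: "nat \<Rightarrow> 'a" and es :: "nat \<Rightarrow> 'a \<Rightarrow> 'f" +
  assumes quasi_greedy: "quasi_greedy scl N e es"
begin

text \<open>Quasi-greediness bounds the remainder for every greedy ordering, in particular for one
  that starts with \<open>A\<close>; the quasi-triangle inequality passes from the remainder to the
  sum.\<close>

lemma greedy_sum_bound:
  "\<exists>C>0. \<forall>x A. finite A \<longrightarrow> (\<forall>n\<in>A. \<forall>k. k \<notin> A \<longrightarrow> norm (es k x) \<le> norm (es n x)) \<longrightarrow>
     N (\<Sum>n\<in>A. scl (es n x) (e n)) \<le> C * N x"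
proof -
  obtain Q where Q: "0 < Q" "\<And>x m. 1 \<le> m \<Longrightarrow> greedy_error scl N e es m x \<le> Q * N x"
    using quasi_greedy unfolding quasi_greedy_def by blast
  obtain c where c: "0 < c" "\<And>n x. norm (es n x) \<le> c * N x" using es_bound by blast
  obtain d where d: "0 < d" "\<And>n. N (e n) \<le> d" using e_bound by blast
  have "N (\<Sum>n\<in>A. scl (es n x) (e n)) \<le> qc * (1 + Q) * N x"
    if A: "finite A" "\<forall>n\<in>A. \<forall>k. k \<notin> A \<longrightarrow> norm (es k x) \<le> norm (es n x)" for A x
  proof (cases "A = {}")
    case True
    then show ?thesis using Q(1) qc_pos nonneg by simp
  next
    case False
    define m where "m = card A"
    have m: "1 \<le> m" using False A(1) by (simp add: m_def Suc_le_eq card_gt_0_iff)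
    define G where "G = (\<lambda>\<pi>. \<Sum>n<m. scl (es (\<pi> n) x) (e (\<pi> n)))"
    obtain \<pi> where \<pi>: "\<pi> \<in> greedy_orderings es x" "\<pi> ` {..<m} = A"
      using greedy_ordering_of_greedy_set[of A x] A unfolding m_def by blast
    \<comment> \<open>Boundedness, with a constant depending on \<open>m\<close>, is what lets the
      real supremum in \<open>greedy_error\<close> dominate its members.\<close>
    have "N (x - G \<pi>') \<le> qc * (N x + qc ^ m * (real m * (c * N x * d)))" for \<pi>'
    proof -
      have "N (scl (es (\<pi>' n) x) (e (\<pi>' n))) \<le> c * N x * d" for n
        using c d nonneg by (simp add: homogeneous mult_mono)
      then have "N (G \<pi>') \<le> qc ^ m * (real m * (c * N x * d))"
        using N_sum_le[of "{..<m}" "\<lambda>n. scl (es (\<pi>' n) x) (e (\<pi>' n))"] by (simp add: G_def)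
      then show ?thesis
        using N_diff[of x "G \<pi>'"] qc_pos by (meson add_left_mono less_imp_le mult_left_mono order_trans)
    qed
    then have "bdd_above ((\<lambda>\<pi>. N (x - G \<pi>)) ` greedy_orderings es x)"
      by (auto intro!: bdd_aboveI)
    then have "N (x - G \<pi>) \<le> greedy_error scl N e es m x"
      unfolding greedy_error_def G_def using \<pi>(1) by (rule cSUP_upper2) simp
    also have "\<dots> \<le> Q * N x" using Q(2) m .
    finally have "N (x - (x - G \<pi>)) \<le> qc * (N x + Q * N x)"
      using N_diff[of x "x - G \<pi>"] qc_pos
      by (meson add_left_mono less_imp_le mult_left_mono order_trans)
    moreover have "(\<Sum>n\<in>A. scl (es n x) (e n)) = G \<pi>"
      unfolding \<pi>(2)[symmetric] G_def using \<pi>(1)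
      by (subst sum.reindex) (auto simp: greedy_orderings_def intro: inj_on_subset)
    ultimately show ?thesis by (simp add: algebra_simps)
  qed
  moreover have "0 < qc * (1 + Q)" using Q(1) qc_pos by simp
  ultimately show ?thesis by blast
qed

text \<open>Every subset of \<open>A\<close> is a greedy set of the signed indicator of \<open>A\<close>, because all nonzero
  coefficients tie.\<close>

lemma signed_indicator_subset_bound:
  "\<exists>C>0. \<forall>A B \<epsilon>. finite A \<longrightarrow> B \<subseteq> A \<longrightarrow> unimodular_on A \<epsilon> \<longrightarrow>
     N (signed_indicator scl e \<epsilon> B) \<le> C * N (signed_indicator scl e \<epsilon> A)"
proof -
  obtain C where C: "0 < C" "\<And>x A. finite A \<Longrightarrow>
      (\<forall>n\<in>A. \<forall>k. k \<notin> A \<longrightarrow> norm (es k x) \<le> norm (es n x)) \<Longrightarrow>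
      N (\<Sum>n\<in>A. scl (es n x) (e n)) \<le> C * N x"
    using greedy_sum_bound by blast
  have "N (signed_indicator scl e \<epsilon> B) \<le> C * N (signed_indicator scl e \<epsilon> A)"
    if A: "finite A" "B \<subseteq> A" "unimodular_on A \<epsilon>" for A B \<epsilon>
  proof -
    define x where "x = signed_indicator scl e \<epsilon> A"
    have x: "es n x = (if n \<in> A then \<epsilon> n else 0)" for n
      using A(1) unfolding x_def signed_indicator_def by (rule es_lincomb)
    have "N (\<Sum>n\<in>B. scl (es n x) (e n)) \<le> C * N x"
      using A finite_subset[OF A(2,1)] by (intro C) (auto simp: x unimodular_on_def)
    moreover have "(\<Sum>n\<in>B. scl (es n x) (e n)) = signed_indicator scl e \<epsilon> B"
      unfolding signed_indicator_def using A(2) by (intro sum.cong) (auto simp: x)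
    ultimately show ?thesis by (simp add: x_def)
  qed
  then show ?thesis using C(1) by blast
qed

lemma level_sum_bound:
  "\<exists>C>0. \<forall>x s. 0 < s \<longrightarrow>
     N (\<Sum>n | s \<le> norm (es n x). scl (es n x) (e n)) \<le> C * N x"
proof -
  obtain C where C: "0 < C" "\<And>x A. finite A \<Longrightarrow>
      (\<forall>n\<in>A. \<forall>k. k \<notin> A \<longrightarrow> norm (es k x) \<le> norm (es n x)) \<Longrightarrow>
      N (\<Sum>n\<in>A. scl (es n x) (e n)) \<le> C * N x"
    using greedy_sum_bound by blast
  then show ?thesis
    by (intro exI[of _ C] conjI allI impI C) (auto intro: finite_level_set)
qed

text \<open>The interval is half-open so that adjacent chunks are disjoint and join without a
  gap.\<close>

definition sign_chunk :: "real \<Rightarrow> real \<Rightarrow> 'a \<Rightarrow> 'a" where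
  "sign_chunk s t x = (\<Sum>n | s \<le> norm (es n x) \<and> norm (es n x) < t. scl (sgn (es n x)) (e n))"

lemma finite_chunk: "0 < s \<Longrightarrow> finite {n. s \<le> norm (es n x) \<and> norm (es n x) < t}"
  using finite_level_set[of s x] by (rule rev_finite_subset) auto

lemma sign_chunk_refl [simp]: "sign_chunk s s x = 0"
  unfolding sign_chunk_def by (rule sum.neutral) auto

lemma sign_chunk_split:
  assumes "0 < s" "s \<le> t" "t \<le> v"
  shows "sign_chunk s v x = sign_chunk s t x + sign_chunk t v x"
proof -
  have "{n. s \<le> norm (es n x) \<and> norm (es n x) < v} =
      {n. s \<le> norm (es n x) \<and> norm (es n x) < t} \<union> {n. t \<le> norm (es n x) \<and> norm (es n x) < v}"
    using assms by auto
  then show ?thesis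
    unfolding sign_chunk_def using assms by (auto intro!: sum.union_disjoint finite_chunk)
qed

text \<open>Signs are invariant under positive scaling, so estimates at height 1 transfer to every
  height.\<close>

lemma sign_chunk_scale:
  assumes "0 < u"
  shows "sign_chunk s t (scl (of_real (1 / u)) x) = sign_chunk (u * s) (u * t) x"
proof -
  have norm_eq: "norm (es n (scl (of_real (1 / u)) x)) = norm (es n x) / u" for n
    using assms by (simp add: norm_divide)
  have sgn_eq: "sgn (es n (scl (of_real (1 / u)) x)) = sgn (es n x)" for n
    using assms sgn_scaleR[of "1 / u" "es n x"] by (simp add: scaleR_conv_of_real)
  show ?thesis
    unfolding sign_chunk_def norm_eq sgn_eq using assms by (intro sum.cong) (auto simp: field_simps)
qed

text \<open>On a chunk whose coefficients lie in \<open>[1, r)\<close> with \<open>r\<close> close to 1, the signed indicator is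
  a perturbation of the projection of \<open>x\<close> that is small relative to the indicator itself.\<close>

lemma sign_chunk_narrow: "\<exists>r>1. \<exists>C>0. \<forall>x. N (sign_chunk 1 r x) \<le> C * N x"
proof -
  obtain L where L: "0 < L" "\<And>x s. 0 < s \<Longrightarrow>
      N (\<Sum>n | s \<le> norm (es n x). scl (es n x) (e n)) \<le> L * N x"
    using level_sum_bound by blast
  obtain C where C: "0 < C" "\<And>A B \<epsilon>. finite A \<Longrightarrow> B \<subseteq> A \<Longrightarrow> unimodular_on A \<epsilon> \<Longrightarrow>
      N (signed_indicator scl e \<epsilon> B) \<le> C * N (signed_indicator scl e \<epsilon> A)"
    using signed_indicator_subset_bound by blast
  obtain D where D: "0 < D"
    "\<And>F (g :: nat \<Rightarrow> 'a) c S. finite F \<Longrightarrow> (\<forall>n\<in>F. 0 \<le> c n \<and> c n \<le> (1::real)) \<Longrightarrow>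
     (\<forall>B\<subseteq>F. N (sum g B) \<le> S) \<Longrightarrow> N (\<Sum>n\<in>F. scl (of_real (c n)) (g n)) \<le> D * S"
    using N_convex_sum[where 'i = nat] by blast
  \<comment> \<open>Convexity (\<open>D\<close>), passage to subsets (\<open>C\<close>) and one
    addition (\<open>qc\<close>) act on the perturbation; this width makes their total factor 1/2,
    so the indicator on the right is absorbed.\<close>
  define \<delta> where "\<delta> = 1 / (2 * qc * D * C)"
  have \<delta>: "0 < \<delta>" "qc * (\<delta> * (D * C)) = 1 / 2"
    using C(1) D(1) qc_pos by (simp_all add: \<delta>_def)
  have "N (sign_chunk 1 (1 + \<delta>) x) \<le> (4 * qc * qc * L) * N x" for x
  proof -
    define A where "A = {n. 1 \<le> norm (es n x) \<and> norm (es n x) < 1 + \<delta>}"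
    define \<epsilon> where "\<epsilon> = (\<lambda>n. sgn (es n x))"
    define y where "y = signed_indicator scl e \<epsilon> A"
    define f where "f = (\<Sum>n\<in>A. scl (es n x) (e n))"
    define c where "c = (\<lambda>n. (norm (es n x) - 1) / \<delta>)"
    have A: "finite A" unfolding A_def by (rule finite_chunk) simp
    have \<epsilon>: "unimodular_on A \<epsilon>" by (auto simp: unimodular_on_def \<epsilon>_def A_def norm_sgn)
    have y: "y = sign_chunk 1 (1 + \<delta>) x"
      by (simp add: y_def sign_chunk_def signed_indicator_def A_def \<epsilon>_def)
    have "{n. 1 \<le> norm (es n x)} = A \<union> {n. 1 + \<delta> \<le> norm (es n x)}" "A \<inter> {n. 1 + \<delta> \<le> norm (es n x)} = {}"
      using \<delta>(1) by (auto simp: A_def)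
    then have f_eq: "f = (\<Sum>n | 1 \<le> norm (es n x). scl (es n x) (e n))
        - (\<Sum>n | 1 + \<delta> \<le> norm (es n x). scl (es n x) (e n))"
      using A \<delta>(1) by (simp add: f_def sum.union_disjoint finite_level_set)
    have Nf: "N f \<le> qc * (L * N x + L * N x)"
      unfolding f_eq using L(2)[of 1 x] L(2)[of "1 + \<delta>" x] \<delta>(1) qc_pos
      by (intro order_trans[OF N_diff] mult_left_mono add_mono) auto
    have "N y \<le> qc * (N f + \<delta> * (D * C * N y))"
    proof -
      have coeff: "es n x - \<epsilon> n = of_real \<delta> * (of_real (c n) * \<epsilon> n)" if "n \<in> A" for n
      proof -
        have "es n x = of_real (norm (es n x)) * \<epsilon> n"
          by (cases "es n x = 0") (auto simp: \<epsilon>_def sgn_div_norm scaleR_conv_of_real)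
        then have "es n x - \<epsilon> n = of_real (norm (es n x) - 1) * \<epsilon> n"
          by (metis left_diff_distrib mult_1 of_real_1 of_real_diff)
        moreover have "norm (es n x) - 1 = \<delta> * c n" using \<delta>(1) by (simp add: c_def)
        ultimately show ?thesis by (simp only: of_real_mult mult.assoc)
      qed
      have "f - y = (\<Sum>n\<in>A. scl (es n x - \<epsilon> n) (e n))"
        by (simp add: f_def y_def signed_indicator_def sum_subtractf scale_left_diff_distrib)
      also have "\<dots> = (\<Sum>n\<in>A. scl (of_real \<delta> * (of_real (c n) * \<epsilon> n)) (e n))"
        using coeff by (intro sum.cong) auto
      also have "\<dots> = scl (of_real \<delta>) (\<Sum>n\<in>A. scl (of_real (c n)) (scl (\<epsilon> n) (e n)))"
        by (simp add: scale_sum_right)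
      finally have "N (f - y) = \<delta> * N (\<Sum>n\<in>A. scl (of_real (c n)) (scl (\<epsilon> n) (e n)))"
        using \<delta>(1) by (simp add: homogeneous)
      also have "\<dots> \<le> \<delta> * (D * (C * N y))"
        using \<delta>(1) A \<epsilon> C(2)[unfolded signed_indicator_def]
        by (intro mult_left_mono D(2)) (auto simp: A_def c_def y_def signed_indicator_def)
      finally have "N (f - y) \<le> \<delta> * (D * C * N y)" by (simp add: mult.assoc)
      then have "N (f - (f - y)) \<le> qc * (N f + \<delta> * (D * C * N y))"
        by (rule order_trans[OF N_diff mult_left_mono[OF add_left_mono]]) (use qc_pos in auto)
      then show ?thesis by simp
    qed
    moreover have expand: "qc * (N f + \<delta> * (D * C * N y)) = qc * N f + (qc * (\<delta> * (D * C))) * N y"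
      by (simp add: algebra_simps)
    ultimately have Ny: "N y \<le> 2 * (qc * N f)" using expand[unfolded \<delta>(2)] by linarith
    have "qc * N f \<le> qc * (qc * (2 * L * N x))" using Nf qc_pos by simp
    then have "2 * (qc * N f) \<le> 4 * qc * qc * L * N x" by (simp add: algebra_simps)
    then show ?thesis using Ny unfolding y by linarith
  qed
  moreover have "0 < 4 * qc * qc * L" using qc_pos L(1) by simp
  moreover have "1 < 1 + \<delta>" using \<delta>(1) by simp
  ultimately show ?thesis by blast
qed

text \<open>The constant grows with each narrow chunk joined, but their number depends only on
  \<open>r\<close> and \<open>qc\<close>. The bound \<open>2 * qc \<le> R\<close> provides the
  contraction for \<open>truncation_bound\<close>.\<close>

lemma sign_chunk_wide: "\<exists>C>0. \<exists>R\<ge>2 * qc. \<forall>x. N (sign_chunk 1 R x) \<le> C * N x"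
proof -
  obtain r C where r: "1 < r" and C: "0 < C" "\<And>x. N (sign_chunk 1 r x) \<le> C * N x"
    using sign_chunk_narrow by blast
  have "\<exists>D>0. \<forall>x. N (sign_chunk 1 (r ^ l) x) \<le> D * N x" for l
  proof (induction l)
    case 0
    have "N (sign_chunk 1 (r ^ 0) x) \<le> 1 * N x" for x
      using nonneg by simp
    then show ?case by (meson zero_less_one)
  next
    case (Suc l)
    then obtain D where D: "0 < D" "\<And>x. N (sign_chunk 1 (r ^ l) x) \<le> D * N x" by blast
    have "N (sign_chunk 1 (r ^ Suc l) x) \<le> qc * (D + C) * N x" for x
    proof -
      have p: "1 \<le> r ^ l" using r by simp
      have "N (sign_chunk (r ^ l) (r ^ Suc l) x) = N (sign_chunk 1 r (scl (of_real (1 / r ^ l)) x))"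
        using p by (subst sign_chunk_scale) (auto simp: mult.commute)
      also have "\<dots> \<le> C * N (scl (of_real (1 / r ^ l)) x)" by (rule C)
      also have "\<dots> \<le> C * N x"
        using C(1) r mult_left_mono[OF p nonneg[of x]]
        by (simp add: homogeneous norm_divide norm_power divide_le_eq)
      finally have "N (sign_chunk 1 (r ^ l) x + sign_chunk (r ^ l) (r ^ Suc l) x) \<le> qc * (D * N x + C * N x)"
        using D(2)[of x] qc_pos by (intro order_trans[OF N_add] mult_left_mono add_mono) auto
      then show ?thesis
        using sign_chunk_split[of 1 "r ^ l" "r ^ Suc l" x] p r by (simp add: algebra_simps)
    qed
    moreover have "0 < qc * (D + C)" using qc_pos C D by simp
    ultimately show ?case by blast
  qed
  moreover obtain l where "2 * qc < r ^ l" using real_arch_pow[OF r] by blast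
  ultimately show ?thesis by (meson less_imp_le)
qed

text \<open>Beyond the first wide chunk, rescaling by \<open>1 / R\<close> reproduces the problem
  with one chunk fewer. The gain \<open>1 / R\<close> beats the loss \<open>qc\<close> of one
  addition, so the constant does not depend on the number of chunks.\<close>

lemma truncation_bound:
  "\<exists>C>0. \<forall>x t. 0 < t \<longrightarrow>
     t * N (\<Sum>n | t \<le> norm (es n x). scl (sgn (es n x)) (e n)) \<le> C * N x"
proof -
  obtain C R where C: "0 < C" "\<And>x. N (sign_chunk 1 R x) \<le> C * N x" and R: "2 * qc \<le> R"
    using sign_chunk_wide by blast
  \<comment> \<open>\<open>K\<close> is the fixed point of the recursion:
    \<open>qc * C + K / 2 = K\<close>.\<close>
  define K where "K = 2 * qc * C"
  have R1: "1 < R" using R qc_ge_1 by linarith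
  have K: "0 < K" using C(1) qc_pos by (simp add: K_def)
  have chunk: "N (sign_chunk 1 (R ^ j) x) \<le> K * N x" for j x
  proof (induction j arbitrary: x)
    case 0 then show ?case using K nonneg by simp
  next
    case (Suc j)
    have "N (sign_chunk R (R ^ Suc j) x) = N (sign_chunk 1 (R ^ j) (scl (of_real (1 / R)) x))"
      using R1 by (subst sign_chunk_scale) auto
    also have "\<dots> \<le> K * N (scl (of_real (1 / R)) x)" by (rule Suc)
    also have "\<dots> = K * N x / R" using R1 by (simp add: homogeneous norm_divide)
    finally have "N (sign_chunk 1 R x + sign_chunk R (R ^ Suc j) x) \<le> qc * (C * N x + K * N x / R)"
      using C(2)[of x] qc_pos by (intro order_trans[OF N_add] mult_left_mono add_mono) auto
    moreover have "sign_chunk 1 (R ^ Suc j) x = sign_chunk 1 R x + sign_chunk R (R ^ Suc j) x"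
      using R1 by (intro sign_chunk_split) (auto simp: mult_le_cancel_left1)
    moreover have "qc * (K * N x / R) \<le> K * N x / 2"
    proof -
      have "qc / R \<le> 1 / 2" using R R1 by (simp add: field_simps)
      then have "(qc / R) * (K * N x) \<le> (1 / 2) * (K * N x)"
        using K nonneg by (intro mult_right_mono) auto
      then show ?thesis by simp
    qed
    ultimately show ?case by (simp add: K_def algebra_simps)
  qed
  obtain c where c: "0 < c" "\<And>n x. norm (es n x) \<le> c * N x" using es_bound by blast
  have "t * N (\<Sum>n | t \<le> norm (es n x). scl (sgn (es n x)) (e n)) \<le> K * N x" if t: "0 < t" for x t
  proof -
    \<comment> \<open>The coefficients of \<open>x\<close> are bounded, so finitely many chunks
      exhaust the level set.\<close>
    obtain j where j: "c * N x / t < R ^ j" using real_arch_pow[OF R1] by blast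
    have "norm (es n x) < t * R ^ j" for n
      using j t c(2)[of n x] by (simp add: field_simps)
    then have "(\<Sum>n | t \<le> norm (es n x). scl (sgn (es n x)) (e n)) = sign_chunk t (t * R ^ j) x"
      by (simp add: sign_chunk_def)
    also have "\<dots> = sign_chunk 1 (R ^ j) (scl (of_real (1 / t)) x)"
      using sign_chunk_scale[OF t, of 1 "R ^ j" x] by simp
    finally show ?thesis
      using chunk[of j "scl (of_real (1 / t)) x"] t by (simp add: homogeneous norm_divide field_simps)
  qed
  then show ?thesis using K by blast
qed

end

section \<open>Superdemocracy implies semi-greediness\<close>

context quasi_greedy_basis
begin

text \<open>On a greedy set \<open>A\<close> with threshold \<open>t\<close>, replace the coefficients of \<open>x\<close> by those of the error
  \<open>v\<close> truncated at height \<open>t\<close>. The result differs from the truncation of \<open>v\<close> only on \<open>B - A\<close>, where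
  the coefficients are at most \<open>2 * t\<close>; superdemocracy compares this part with \<open>v\<close> on \<open>A - B\<close>.\<close>

lemma chebyshev_approximant:
  assumes D: "0 < D" "\<And>A \<epsilon>. finite A \<Longrightarrow> unimodular_on A \<epsilon> \<Longrightarrow>
      upper_democracy scl N e (card A) \<le> D * N (signed_indicator scl e \<epsilon> A)"
  shows "\<exists>C>0. \<forall>x A B b. finite A \<longrightarrow> A \<noteq> {} \<longrightarrow>
    (\<forall>n\<in>A. \<forall>k. k \<notin> A \<longrightarrow> norm (es k x) \<le> norm (es n x)) \<longrightarrow> finite B \<longrightarrow> card B = card A \<longrightarrow>
    (\<exists>a. N (x - (\<Sum>n\<in>A. scl (a n) (e n))) \<le> C * N (x - (\<Sum>n\<in>B. scl (b n) (e n))))"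
proof -
  obtain L where L: "0 < L" "\<And>x s. 0 < s \<Longrightarrow>
      N (\<Sum>n | s \<le> norm (es n x). scl (es n x) (e n)) \<le> L * N x"
    using level_sum_bound by blast
  obtain S where S: "0 < S" "\<And>A B \<epsilon>. finite A \<Longrightarrow> B \<subseteq> A \<Longrightarrow> unimodular_on A \<epsilon> \<Longrightarrow>
      N (signed_indicator scl e \<epsilon> B) \<le> S * N (signed_indicator scl e \<epsilon> A)"
    using signed_indicator_subset_bound by blast
  obtain T where T: "0 < T" "\<And>x t. 0 < t \<Longrightarrow>
      t * N (\<Sum>n | t \<le> norm (es n x). scl (sgn (es n x)) (e n)) \<le> T * N x"
    using truncation_bound by blast
  obtain U where U: "0 < U" "\<And>F c t. finite F \<Longrightarrow> (\<forall>n\<in>F. norm (c n) \<le> t) \<Longrightarrow> 0 < t \<Longrightarrow>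
      N (\<Sum>n\<in>F. scl (c n) (e n)) \<le> U * t * upper_democracy scl N e (card F)"
    using bounded_lincomb_le_upper_democracy by blast
  define C where "C = qc * (qc * (qc * (1 + L) + T) + 2 * U * D * S * T)"
  have C: "0 < C" using L(1) S(1) T(1) U(1) D(1) qc_pos by (simp add: C_def add_pos_pos)
  have "\<exists>a. N (x - (\<Sum>n\<in>A. scl (a n) (e n))) \<le> C * N (x - (\<Sum>n\<in>B. scl (b n) (e n)))"
    if A: "finite A" "A \<noteq> {}" "\<forall>n\<in>A. \<forall>k. k \<notin> A \<longrightarrow> norm (es k x) \<le> norm (es n x)"
      and B: "finite B" "card B = card A" for x A B and b :: "nat \<Rightarrow> 'f"
  proof -
    define v where "v = x - (\<Sum>n\<in>B. scl (b n) (e n))"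
    have v: "es n v = es n x" if "n \<notin> B" for n using that B(1) by (simp add: v_def es_lincomb del: es_sum)
    define t where "t = Min ((\<lambda>n. norm (es n x)) ` A)"
    have "t \<in> (\<lambda>n. norm (es n x)) ` A" unfolding t_def using A(1,2) by (intro Min_in) auto
    then have tA: "t \<le> norm (es n x)" if "n \<in> A" for n using A(1) that by (simp add: t_def)
    have tnA: "norm (es n x) \<le> t" if "n \<notin> A" for n
      using \<open>t \<in> _\<close> A(3) that by auto
    have t0: "0 \<le> t" using \<open>t \<in> _\<close> by auto
    show ?thesis
    proof (cases "t = 0")
      case True
      \<comment> \<open>With threshold 0 the support of \<open>x\<close> lies in \<open>A\<close>,
        and its own coefficients leave no error.\<close>
      have "x - (\<Sum>n\<in>A. scl (es n x) (e n)) = 0"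
        by (rule es_total) (use A(1) tnA True in \<open>auto simp: es_lincomb simp del: es_sum\<close>)
      then show ?thesis using C nonneg by (intro exI[of _ "\<lambda>n. es n x"]) simp
    next
      case False
      then have t: "0 < t" using t0 by simp
      define G where "G = {n. t \<le> norm (es n v)}"
      have G: "finite G" unfolding G_def using t by (rule finite_level_set)
      define \<epsilon> where "\<epsilon> = (\<lambda>n. sgn (es n v))"
      have \<epsilon>: "unimodular_on G \<epsilon>" using t by (auto simp: unimodular_on_def \<epsilon>_def G_def norm_sgn)
      define u where "u = signed_indicator scl e \<epsilon> G"
      have Nu: "t * N u \<le> T * N v"
        using T(2)[OF t, of v] by (simp add: u_def signed_indicator_def G_def \<epsilon>_def)
      define z where "z = v - (\<Sum>n\<in>G. scl (es n v) (e n)) + scl (of_real t) u"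
      have z: "es n z = (if n \<in> G then of_real t * \<epsilon> n else es n v)" for n
        using G by (simp add: z_def u_def signed_indicator_def es_lincomb del: es_sum)
      have z_le: "norm (es n z) \<le> t" for n
        using t by (auto simp: z norm_mult \<epsilon>_def norm_sgn G_def)
      \<comment> \<open>At the tie \<open>norm (es n v) = t\<close> clipping changes nothing, so the
        closed inequality is enough; this matters for indices outside \<open>A\<close> and
        \<open>B\<close>.\<close>
      have z_eq: "es n z = es n v" if "norm (es n v) \<le> t" for n
        using that t by (auto simp: z \<epsilon>_def G_def sgn_div_norm scaleR_conv_of_real)
      define w where "w = x - (\<Sum>n\<in>A. scl (es n x - es n z) (e n))"
      define y where "y = (\<Sum>n\<in>B - A. scl (es n x - es n z) (e n))"
      have "w - (z + y) = 0"
      proof (rule es_total)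
        fix n
        have "es n w = (if n \<in> A then es n z else es n x)"
          using A(1) by (simp add: w_def es_lincomb del: es_sum)
        moreover have "es n y = (if n \<in> B - A then es n x - es n z else 0)"
          unfolding y_def using B(1) by (intro es_lincomb) simp
        moreover have "es n z = es n x" if "n \<notin> A" "n \<notin> B"
          using z_eq[of n] v[OF that(2)] tnA[OF that(1)] by simp
        ultimately show "es n (w - (z + y)) = 0" by auto
      qed
      then have w: "w = z + y" by simp
      have "N (v - (\<Sum>n\<in>G. scl (es n v) (e n))) \<le> qc * (N v + L * N v)"
        using L(2)[OF t, of v] qc_pos unfolding G_def
        by (intro order_trans[OF N_diff] mult_left_mono add_left_mono) auto
      then have Nz: "N z \<le> qc * (qc * (N v + L * N v) + T * N v)"
        unfolding z_def using Nu t qc_pos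
        by (intro order_trans[OF N_add] mult_left_mono add_mono) (auto simp: homogeneous)
      have "N y \<le> U * (2 * t) * upper_democracy scl N e (card (B - A))"
        unfolding y_def
      proof (rule U(2))
        show "\<forall>n\<in>B - A. norm (es n x - es n z) \<le> 2 * t"
        proof
          fix n assume "n \<in> B - A"
          then have "norm (es n x) \<le> t" using tnA by simp
          then show "norm (es n x - es n z) \<le> 2 * t"
            using norm_triangle_ineq4[of "es n x" "es n z"] z_le[of n] by linarith
        qed
      qed (use B(1) t in auto)
      also have "card (B - A) = card (A - B)"
        using A(1) B by (simp add: card_Diff_subset_Int Int_commute)
      also have "U * (2 * t) * upper_democracy scl N e (card (A - B)) \<le> U * (2 * t) * (D * (S * N u))"
      proof (intro mult_left_mono)
        \<comment> \<open>Off \<open>B\<close> the vectors \<open>v\<close> and \<open>x\<close>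
          have equal coefficients, and on \<open>A\<close> those of \<open>x\<close> reach the
          threshold. Hence \<open>A - B\<close> consists of clipped indices of \<open>v\<close>, and
          its indicator is controlled by \<open>u\<close>.\<close>
        have AG: "A - B \<subseteq> G" using tA v by (auto simp: G_def)
        have "upper_democracy scl N e (card (A - B)) \<le> D * N (signed_indicator scl e \<epsilon> (A - B))"
          using A(1) \<epsilon> AG by (intro D(2)) (auto simp: unimodular_on_def)
        also have "\<dots> \<le> D * (S * N u)"
          unfolding u_def using D(1) G AG \<epsilon> by (intro mult_left_mono S(2)) auto
        finally show "upper_democracy scl N e (card (A - B)) \<le> D * (S * N u)" .
      qed (use U(1) t in auto)
      also have "\<dots> = 2 * U * D * S * (t * N u)" by simp
      also have "\<dots> \<le> 2 * U * D * S * (T * N v)"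
        using Nu U(1) D(1) S(1) by (intro mult_left_mono) auto
      finally have "N (z + y) \<le> qc * (qc * (qc * (N v + L * N v) + T * N v) + 2 * U * D * S * (T * N v))"
        using Nz qc_pos by (intro order_trans[OF N_add] mult_left_mono add_mono) auto
      also have "\<dots> = C * N v" by (simp add: C_def algebra_simps)
      finally show ?thesis
        unfolding w[symmetric] w_def v_def by (intro exI)
    qed
  qed
  then show ?thesis using C by blast
qed

lemma semi_greedy_if_superdemocratic:
  assumes D: "0 < D" "\<And>A \<epsilon>. finite A \<Longrightarrow> unimodular_on A \<epsilon> \<Longrightarrow>
      upper_democracy scl N e (card A) \<le> D * N (signed_indicator scl e \<epsilon> A)"
  shows "semi_greedy scl N e es"
proof -
  obtain C where C: "0 < C" "\<And>x A B b. finite A \<Longrightarrow> A \<noteq> {} \<Longrightarrow>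
    (\<forall>n\<in>A. \<forall>k. k \<notin> A \<longrightarrow> norm (es k x) \<le> norm (es n x)) \<Longrightarrow> finite B \<Longrightarrow> card B = card A \<Longrightarrow>
    (\<exists>a. N (x - (\<Sum>n\<in>A. scl (a n) (e n))) \<le> C * N (x - (\<Sum>n\<in>B. scl (b n) (e n))))"
    using chebyshev_approximant[OF D] by blast
  have "chebyshev_error scl N e es m x \<le> C * best_error scl N e m x" if m: "1 \<le> m" for x m
  proof -
    have le: "chebyshev_error scl N e es m x \<le> C * N (x - (\<Sum>n\<in>B. scl (b n) (e n)))"
      if B: "finite B" "card B = m" for B b
      unfolding chebyshev_error_def
    proof (rule cSUP_least[OF greedy_orderings_nonempty])
      fix \<pi> assume "\<pi> \<in> greedy_orderings es x"
      then have inj: "inj \<pi>" and supp: "supp es x \<subseteq> range \<pi>"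
        and dec: "\<And>i j. i \<le> j \<Longrightarrow> norm (es (\<pi> j) x) \<le> norm (es (\<pi> i) x)"
        by (auto simp: greedy_orderings_def)
      \<comment> \<open>An index outside \<open>range \<pi>\<close> has coefficient 0, so only
        indices enumerated after position \<open>m\<close> need comparison.\<close>
      have greedy: "norm (es k x) \<le> norm (es n x)" if n: "n \<in> \<pi> ` {..<m}" and k: "k \<notin> \<pi> ` {..<m}" for n k
      proof (cases "es k x = 0")
        case False
        then obtain j where j: "k = \<pi> j" using supp by (auto simp: supp_def)
        then have "m \<le> j" using k by (meson image_eqI lessThan_iff not_less)
        then show ?thesis using n j dec by auto
      qed simp
      have card: "card (\<pi> ` {..<m}) = m" using inj by (simp add: card_image inj_on_subset)
      have nonempty: "\<pi> ` {..<m} \<noteq> {}" using m by (auto simp: lessThan_empty_iff)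
      obtain a where a: "N (x - (\<Sum>n\<in>\<pi> ` {..<m}. scl (a n) (e n))) \<le> C * N (x - (\<Sum>n\<in>B. scl (b n) (e n)))"
        using C(2)[of "\<pi> ` {..<m}" x B b] greedy nonempty B card by auto
      have "(\<Sum>n\<in>\<pi> ` {..<m}. scl (a n) (e n)) = (\<Sum>n<m. scl (a (\<pi> n)) (e (\<pi> n)))"
        using inj by (subst sum.reindex) (auto intro: inj_on_subset)
      then show "(INF a. N (x - (\<Sum>n<m. scl (a n) (e (\<pi> n))))) \<le> C * N (x - (\<Sum>n\<in>B. scl (b n) (e n)))"
        using a chebyshev_inner_bounds(3)[where a = "\<lambda>n. a (\<pi> n)" and x = x and m = m and \<pi> = \<pi>] by simp
    qed
    have "chebyshev_error scl N e es m x / C \<le> best_error scl N e m x"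
      by (rule best_error_greatest) (use le C(1) in \<open>simp add: field_simps\<close>)
    then show ?thesis using C(1) by (simp add: field_simps)
  qed
  then show ?thesis unfolding semi_greedy_def using C(1) by blast
qed

end

section \<open>Weights and approximation classes\<close>

lemma weight_mono:
  assumes "weight \<omega>" "1 \<le> m" "m \<le> n"
  shows "\<omega> m \<le> \<omega> n"
  using assms(3)
proof (induction rule: dec_induct)
  case (step n)
  then have "\<omega> n \<le> \<omega> (Suc n)" using assms(1,2) by (simp add: weight_def)
  then show ?case using step by simp
qed simp

lemma weight_pos: "weight \<omega> \<Longrightarrow> 1 \<le> n \<Longrightarrow> 0 < \<omega> n"
  using weight_mono[of \<omega> 1 n] by (auto simp: weight_def)

text \<open>A positive supremum is witnessed by a single \<open>M\<close>. Monotonicity makes every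
  quotient at least 1, which bounds the infimum below and turns the positive logarithm into a factor
  above 1.\<close>

lemma dilation_factor_exists:
  assumes w: "weight \<omega>" and index: "0 < lower_dilation_index \<omega>"
  shows "\<exists>M\<ge>2. \<exists>\<phi>>1. \<forall>k\<ge>1. \<phi> * \<omega> k \<le> \<omega> (M * k)"
proof -
  obtain M where M: "2 \<le> M" "0 < ereal (ln (dilation \<omega> M) / ln (real M))"
    using index unfolding lower_dilation_index_def less_SUP_iff by auto
  have "0 < ln (real M)" using M(1) by simp
  then have ln_pos: "0 < ln (dilation \<omega> M)" using M(2) by (auto simp: zero_less_divide_iff)
  have ge_1: "1 \<le> \<omega> (M * k) / \<omega> k" if "1 \<le> k" for k
  proof -
    have "k \<le> M * k" using M(1) by simp
    then show ?thesis
      using weight_mono[OF w that] weight_pos[OF w that] by simp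
  qed
  then have "1 \<le> dilation \<omega> M" unfolding dilation_def by (intro cINF_greatest) auto
  then have "1 < dilation \<omega> M" using ln_pos by (cases "dilation \<omega> M = 1") auto
  moreover have "dilation \<omega> M * \<omega> k \<le> \<omega> (M * k)" if k: "1 \<le> k" for k
  proof -
    have "bdd_below ((\<lambda>k. \<omega> (M * k) / \<omega> k) ` {1..})"
      using ge_1 by (intro bdd_belowI[of _ 1]) auto
    then have "dilation \<omega> M \<le> \<omega> (M * k) / \<omega> k"
      unfolding dilation_def using k by (intro cINF_lower) auto
    then show ?thesis using weight_pos[OF w k] by (simp add: field_simps)
  qed
  ultimately show ?thesis using M(1) by blast
qed

text \<open>Iterating the dilation by \<open>M\<close> multiplies the factor, which thus exceeds any
  prescribed \<open>c\<close>.\<close>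

lemma weight_growth:
  assumes w: "weight \<omega>" and index: "0 < lower_dilation_index \<omega>"
  shows "\<exists>T\<ge>1. \<forall>k\<ge>1. c * \<omega> k \<le> \<omega> (T * k)"
proof -
  obtain M \<phi> where M: "2 \<le> M" and \<phi>: "1 < \<phi>" "\<And>k. 1 \<le> k \<Longrightarrow> \<phi> * \<omega> k \<le> \<omega> (M * k)"
    using dilation_factor_exists[OF assms] by blast
  have pow: "\<phi> ^ p * \<omega> k \<le> \<omega> (M ^ p * k)" if k: "1 \<le> k" for p k
  proof (induction p)
    case (Suc p)
    have "1 \<le> M ^ p * k" using k M by (simp add: Suc_le_eq)
    then have "\<phi> * \<omega> (M ^ p * k) \<le> \<omega> (M * (M ^ p * k))" by (rule \<phi>(2))
    moreover have "\<phi> * (\<phi> ^ p * \<omega> k) \<le> \<phi> * \<omega> (M ^ p * k)" using Suc \<phi>(1) by simp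
    ultimately show ?case by (simp add: mult.assoc)
  qed simp
  obtain p where p: "c < \<phi> ^ p" using real_arch_pow[OF \<phi>(1)] by blast
  have "c * \<omega> k \<le> \<omega> (M ^ p * k)" if "1 \<le> k" for k
    using mult_right_mono[OF less_imp_le[OF p], of "\<omega> k"] weight_pos[OF w that] pow[OF that, of p]
    by linarith
  then show ?thesis using M by (intro exI[of _ "M ^ p"]) simp
qed

text \<open>Induction from \<open>s div M\<close> to \<open>s\<close>: the initial part gains the
  factor \<open>1 / \<psi>\<close>, while the last block has at most \<open>M * Suc t\<close> terms,
  each at most \<open>\<omega> s powr p / Suc t\<close>.\<close>

lemma weighted_power_sum_bound:
  assumes w: "weight \<omega>" and index: "0 < lower_dilation_index \<omega>" and p: "0 < p"
  shows "\<exists>C>0. \<forall>s\<ge>1. (\<Sum>k=1..s. \<omega> k powr p / real k) \<le> C * \<omega> s powr p"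
proof -
  obtain M \<phi> where M: "2 \<le> M" and \<phi>: "1 < \<phi>" "\<And>k. 1 \<le> k \<Longrightarrow> \<phi> * \<omega> k \<le> \<omega> (M * k)"
    using dilation_factor_exists[OF w index] by blast
  define \<psi> where "\<psi> = \<phi> powr p"
  have \<psi>: "1 < \<psi>" using \<phi>(1) p by (simp add: \<psi>_def)
  \<comment> \<open>Chosen so that the induction closes: \<open>C / \<psi> + M = C\<close>.\<close>
  define C where "C = real M / (1 - 1 / \<psi>)"
  have C: "0 < C" "C / \<psi> + real M = C" using \<psi> M by (auto simp: C_def field_simps)
  have "(\<Sum>k=1..s. \<omega> k powr p / real k) \<le> C * \<omega> s powr p" if "1 \<le> s" for s
    using that
  proof (induction s rule: less_induct)
    case (less s)
    define t where "t = s div M"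
    have t: "t < s" "s < M * Suc t"
      using less.prems M by (auto simp: t_def dividend_less_times_div algebra_simps)
    have "(\<Sum>k=1..t. \<omega> k powr p / real k) \<le> C / \<psi> * \<omega> s powr p"
    proof (cases "1 \<le> t")
      case True
      have "\<phi> * \<omega> t \<le> \<omega> s"
        using \<phi>(2)[OF True] weight_mono[OF w, of "M * t" s] True M by (auto simp: t_def)
      then have "(\<phi> * \<omega> t) powr p \<le> \<omega> s powr p"
        using \<phi>(1) weight_pos[OF w True] p by (intro powr_mono2) auto
      then have "\<psi> * \<omega> t powr p \<le> \<omega> s powr p"
        using \<phi>(1) weight_pos[OF w True] by (simp add: \<psi>_def powr_mult)
      then have "C / \<psi> * (\<psi> * \<omega> t powr p) \<le> C / \<psi> * \<omega> s powr p"
        using C(1) \<psi> by (intro mult_left_mono) auto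
      moreover have "C / \<psi> * (\<psi> * \<omega> t powr p) = C * \<omega> t powr p" using \<psi> by simp
      ultimately show ?thesis using less.IH[OF t(1) True] by linarith
    qed (use C(1) \<psi> in auto)
    moreover have "(\<Sum>k=Suc t..s. \<omega> k powr p / real k) \<le> real M * \<omega> s powr p"
    proof -
      have "\<omega> k powr p / real k \<le> \<omega> s powr p / real (Suc t)" if "k \<in> {Suc t..s}" for k
        using that weight_mono[OF w, of k s] weight_pos[OF w, of k] p
        by (intro frac_le powr_mono2) auto
      then have "(\<Sum>k=Suc t..s. \<omega> k powr p / real k) \<le> real (card {Suc t..s}) * (\<omega> s powr p / real (Suc t))"
        by (rule sum_bounded_above)
      also have "\<dots> \<le> (real M * real (Suc t)) * (\<omega> s powr p / real (Suc t))"
      proof (rule mult_right_mono)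
        have "card {Suc t..s} \<le> M * Suc t" using t(2) by simp
        then show "real (card {Suc t..s}) \<le> real M * real (Suc t)"
          by (metis of_nat_le_iff of_nat_mult)
      qed simp
      also have "\<dots> = real M * \<omega> s powr p" by simp
      finally show ?thesis .
    qed
    moreover have "(\<Sum>k=1..s. \<omega> k powr p / real k) =
        (\<Sum>k=1..t. \<omega> k powr p / real k) + (\<Sum>k=Suc t..s. \<omega> k powr p / real k)"
      using t(1) sum.ub_add_nat[of 1 t "\<lambda>k. \<omega> k powr p / real k" "s - t"] by simp
    ultimately have "(\<Sum>k=1..s. \<omega> k powr p / real k) \<le> (C / \<psi> + real M) * \<omega> s powr p"
      by (simp add: distrib_right)
    then show ?case using C(2) by simp
  qed
  then show ?thesis using C(1) by blast
qed

section \<open>Norm estimates and embeddings for approximation classes\<close>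

lemma enn2real_pos: "0 < q \<Longrightarrow> q \<noteq> \<infinity> \<Longrightarrow> 0 < enn2real q"
  by (cases q) (auto simp: ennreal_less_zero_iff)

text \<open>Tailored to the best errors of a two-block vector, which are bounded by a step function
  with levels \<open>a\<close>, \<open>b\<close> and 0. By the power sum bound each level
  contributes through its last index.\<close>

lemma error_class_norm_upper:
  fixes E :: "nat \<Rightarrow> 'a \<Rightarrow> real" and N :: "'a \<Rightarrow> real"
  assumes w: "weight \<omega>" and index: "0 < lower_dilation_index \<omega>" and q: "0 < q"
  shows "\<exists>C>0. \<forall>x s t a b. 1 \<le> s \<longrightarrow> s \<le> t \<longrightarrow> 0 \<le> a \<longrightarrow> 0 \<le> b \<longrightarrow> (\<forall>k. 0 \<le> E k x) \<longrightarrow>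
    (\<forall>k\<le>s. E k x \<le> a) \<longrightarrow> (\<forall>k>s. E k x \<le> b) \<longrightarrow> (\<forall>k>t. E k x = 0) \<longrightarrow>
    x \<in> error_class \<omega> q E \<and> error_class_norm N \<omega> q E x \<le> N x + C * (a * \<omega> s + b * \<omega> t)"
proof (cases "q = \<infinity>")
  case True
  have "x \<in> error_class \<omega> q E \<and> error_class_norm N \<omega> q E x \<le> N x + 1 * (a * \<omega> s + b * \<omega> t)"
    if h: "1 \<le> s" "s \<le> t" "0 \<le> a" "0 \<le> b" "\<forall>k. 0 \<le> E k x" "\<forall>k\<le>s. E k x \<le> a"
      "\<forall>k>s. E k x \<le> b" "\<forall>k>t. E k x = 0" for x s t a b
  proof -
    have pos: "0 \<le> a * \<omega> s" "0 \<le> b * \<omega> t"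
      using h weight_pos[OF w, of s] weight_pos[OF w, of t] by auto
    have le: "\<omega> n * E n x \<le> a * \<omega> s + b * \<omega> t" if n: "1 \<le> n" for n
    proof -
      consider "n \<le> s" | "s < n" "n \<le> t" | "t < n" by linarith
      then show ?thesis
      proof cases
        case 1
        then have "\<omega> n * E n x \<le> \<omega> s * a"
          using h n weight_mono[OF w n] weight_pos[OF w h(1)] by (intro mult_mono) auto
        then show ?thesis using pos by (simp add: mult.commute)
      next
        case 2
        then have "\<omega> n * E n x \<le> \<omega> t * b"
          using h n weight_mono[OF w n] weight_pos[OF w, of t] by (intro mult_mono) auto
        then show ?thesis using pos by (simp add: mult.commute)
      next
        case 3 then show ?thesis using h pos by simp
      qed
    qed
    then have "bdd_above ((\<lambda>n. \<omega> n * E n x) ` {1..})" by (auto intro!: bdd_aboveI)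
    moreover have "(SUP n\<in>{1..}. \<omega> n * E n x) \<le> a * \<omega> s + b * \<omega> t"
      using le by (intro cSUP_least) auto
    ultimately show ?thesis using True by (simp add: error_class_def error_class_norm_def)
  qed
  then show ?thesis
    by - (rule exI[of _ 1], rule conjI[OF zero_less_one], intro allI impI)
next
  case False
  define p where "p = enn2real q"
  have p: "0 < p" unfolding p_def using q False by (rule enn2real_pos)
  obtain C where C: "0 < C" "\<And>s. 1 \<le> s \<Longrightarrow> (\<Sum>k=1..s. \<omega> k powr p / real k) \<le> C * \<omega> s powr p"
    using weighted_power_sum_bound[OF w index p] by blast
  have "x \<in> error_class \<omega> q E \<and>
      error_class_norm N \<omega> q E x \<le> N x + (2 * C) powr (1 / p) * (a * \<omega> s + b * \<omega> t)"
    if h: "1 \<le> s" "s \<le> t" "0 \<le> a" "0 \<le> b" "\<forall>k. 0 \<le> E k x" "\<forall>k\<le>s. E k x \<le> a"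
      "\<forall>k>s. E k x \<le> b" "\<forall>k>t. E k x = 0" for x s t a b
  proof -
    define f where "f = (\<lambda>n. (\<omega> (Suc n) * E (Suc n) x) powr p * (1 / real (Suc n)))"
    define g where "g = (\<lambda>n. \<omega> (Suc n) powr p / real (Suc n))"
    have g0: "0 \<le> g n" for n by (simp add: g_def)
    have zero: "f n = 0" if "n \<notin> {..<t}" for n using that h p by (simp add: f_def)
    have sum_g: "(\<Sum>n<r. g n) \<le> C * \<omega> r powr p" if "1 \<le> r" for r
      using C(2)[OF that] by (simp add: g_def sum.atLeast1_atMost_eq)
    have f_le: "f n \<le> c powr p * g n" if "E (Suc n) x \<le> c" for n c
    proof -
      have "(\<omega> (Suc n) * E (Suc n) x) powr p \<le> (\<omega> (Suc n) * c) powr p"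
        using that h p weight_pos[OF w, of "Suc n"] by (intro powr_mono2 mult_left_mono) auto
      also have "\<dots> = \<omega> (Suc n) powr p * c powr p"
        by (rule powr_mult)
      finally have "(\<omega> (Suc n) * E (Suc n) x) powr p / real (Suc n) \<le>
          (\<omega> (Suc n) powr p * c powr p) / real (Suc n)"
        by (rule divide_right_mono) simp
      then show ?thesis by (simp add: f_def g_def mult.commute)
    qed
    have pos: "0 \<le> a * \<omega> s" "0 \<le> b * \<omega> t"
      using h weight_pos[OF w, of s] weight_pos[OF w, of t] by auto
    have "(\<Sum>n<t. f n) = (\<Sum>n<s. f n) + (\<Sum>n=s..<t. f n)"
      using h(2) by (metis lessThan_atLeast0 sum.atLeastLessThan_concat zero_le)
    also have "\<dots> \<le> (\<Sum>n<s. a powr p * g n) + (\<Sum>n=s..<t. b powr p * g n)"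
      using h f_le by (intro add_mono sum_mono) auto
    \<comment> \<open>Adding the terms below \<open>s\<close> makes the power sum bound applicable
      from the start.\<close>
    also have "(\<Sum>n=s..<t. b powr p * g n) \<le> (\<Sum>n<t. b powr p * g n)"
      using g0 by (intro sum_mono2) auto
    finally have "(\<Sum>n<t. f n) \<le> a powr p * (\<Sum>n<s. g n) + b powr p * (\<Sum>n<t. g n)"
      by (simp add: sum_distrib_left)
    also have "\<dots> \<le> a powr p * (C * \<omega> s powr p) + b powr p * (C * \<omega> t powr p)"
      using h sum_g by (intro add_mono mult_left_mono) auto
    also have "\<dots> = C * (a * \<omega> s) powr p + C * (b * \<omega> t) powr p"
      using h weight_pos[OF w, of s] weight_pos[OF w, of t] by (simp add: powr_mult)
    \<comment> \<open>Bounding both powers by the power of the sum costs a factor 2 and works for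
      every \<open>p > 0\<close>, including \<open>p < 1\<close>.\<close>
    also have "\<dots> \<le> C * (a * \<omega> s + b * \<omega> t) powr p + C * (a * \<omega> s + b * \<omega> t) powr p"
      using C(1) pos p by (intro add_mono mult_left_mono powr_mono2) auto
    finally have "(\<Sum>n<t. f n) \<le> (2 * C) * (a * \<omega> s + b * \<omega> t) powr p" by simp
    then have "(\<Sum>n<t. f n) powr (1 / p) \<le> ((2 * C) * (a * \<omega> s + b * \<omega> t) powr p) powr (1 / p)"
      using p by (intro powr_mono2 sum_nonneg) (auto simp: f_def)
    also have "\<dots> = (2 * C) powr (1 / p) * (a * \<omega> s + b * \<omega> t)"
      using C(1) p pos by (simp add: powr_mult powr_powr)
    finally have le: "(\<Sum>n<t. f n) powr (1 / p) \<le> (2 * C) powr (1 / p) * (a * \<omega> s + b * \<omega> t)" .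
    have "summable f" "suminf f = (\<Sum>n<t. f n)"
      using zero by (auto intro!: summable_finite[of "{..<t}"] suminf_finite)
    then show ?thesis
      using False le by (simp add: error_class_def error_class_norm_def f_def p_def)
  qed
  moreover have "0 < (2 * C) powr (1 / p)" using C(1) by simp
  ultimately show ?thesis by blast
qed

text \<open>For finite \<open>q\<close>, the upper half of the range suffices: there doubling keeps
  the weight comparable to \<open>\<omega> n\<close>, and the harmonic weights have total mass at
  least 1/2.\<close>

lemma error_class_norm_lower:
  fixes E :: "nat \<Rightarrow> 'a \<Rightarrow> real" and N :: "'a \<Rightarrow> real"
  assumes w: "doubling_weight \<omega>" and q: "0 < q"
  shows "\<exists>c>0. \<forall>x n a. 1 \<le> n \<longrightarrow> 0 \<le> a \<longrightarrow> 0 \<le> N x \<longrightarrow> (\<forall>k. 0 \<le> E k x) \<longrightarrow>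
    (\<forall>k\<in>{1..n}. a \<le> E k x) \<longrightarrow> x \<in> error_class \<omega> q E \<longrightarrow>
    c * (a * \<omega> n) \<le> error_class_norm N \<omega> q E x"
proof (cases "q = \<infinity>")
  case True
  have "1 * (a * \<omega> n) \<le> error_class_norm N \<omega> q E x"
    if h: "1 \<le> n" "0 \<le> N x" "\<forall>k\<in>{1..n}. a \<le> E k x" "x \<in> error_class \<omega> q E" for x n a
  proof -
    have "\<omega> n * E n x \<le> (SUP n\<in>{1..}. \<omega> n * E n x)"
      using h True by (intro cSUP_upper) (auto simp: error_class_def)
    moreover have "\<omega> n * a \<le> \<omega> n * E n x"
      using h weight_pos[of \<omega> n] w by (intro mult_left_mono) (auto simp: doubling_weight_def)
    ultimately show ?thesis using h True by (simp add: error_class_norm_def mult.commute)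
  qed
  then show ?thesis by (intro exI[of _ "1::real"]) simp
next
  case False
  define p where "p = enn2real q"
  have p: "0 < p" unfolding p_def using q False by (rule enn2real_pos)
  obtain \<theta> where \<theta>: "1 \<le> \<theta>" "\<And>n. 1 \<le> n \<Longrightarrow> \<omega> (2 * n) \<le> \<theta> * \<omega> n" and w': "weight \<omega>"
    using w unfolding doubling_weight_def by blast
  have "(1 / 2) powr (1 / p) / \<theta> * (a * \<omega> n) \<le> error_class_norm N \<omega> q E x"
    if h: "1 \<le> n" "0 \<le> a" "0 \<le> N x" "\<forall>k. 0 \<le> E k x" "\<forall>k\<in>{1..n}. a \<le> E k x"
      "x \<in> error_class \<omega> q E" for x n a
  proof -
    define f where "f = (\<lambda>n. (\<omega> (Suc n) * E (Suc n) x) powr p * (1 / real (Suc n)))"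
    define z where "z = a * \<omega> n / \<theta>"
    have z: "0 \<le> z" using h \<theta>(1) weight_pos[OF w' h(1)] by (simp add: z_def)
    have f: "summable f" using h(6) False by (simp add: error_class_def f_def p_def)
    \<comment> \<open>Position \<open>i\<close> of the series carries the error of order
      \<open>Suc i\<close>, whence \<open>n \<le> 2 * Suc i\<close> even for odd
      \<open>n\<close>.\<close>
    have f_ge: "z powr p / real n \<le> f i" if i: "i \<in> {n div 2..<n}" for i
    proof -
      have "n \<le> 2 * Suc i" using i by auto
      then have "\<omega> n \<le> \<theta> * \<omega> (Suc i)"
        using weight_mono[OF w' h(1), of "2 * Suc i"] \<theta>(2)[of "Suc i"] by simp
      then have "\<omega> n / \<theta> \<le> \<omega> (Suc i)" using \<theta>(1) by (simp add: field_simps)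
      then have "(\<omega> n / \<theta>) * a \<le> \<omega> (Suc i) * E (Suc i) x"
        using i h weight_pos[OF w', of "Suc i"] by (intro mult_mono) auto
      then have "z powr p \<le> (\<omega> (Suc i) * E (Suc i) x) powr p"
        using z p by (intro powr_mono2) (auto simp: z_def mult.commute)
      then have "z powr p / real n \<le> (\<omega> (Suc i) * E (Suc i) x) powr p / real (Suc i)"
        using i h by (intro frac_le) auto
      then show ?thesis by (simp add: f_def)
    qed
    have "(1 / 2) * z powr p = (real n / 2) * (z powr p / real n)" using h(1) by simp
    also have "\<dots> \<le> real (card {n div 2..<n}) * (z powr p / real n)"
      by (intro mult_right_mono) auto
    also have "\<dots> \<le> (\<Sum>i=n div 2..<n. f i)" using f_ge by (intro sum_bounded_below) auto
    also have "\<dots> \<le> suminf f" using f by (intro sum_le_suminf) (auto simp: f_def)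
    finally have "((1 / 2) * z powr p) powr (1 / p) \<le> suminf f powr (1 / p)"
      using p by (intro powr_mono2) auto
    moreover have "((1 / 2) * z powr p) powr (1 / p) = (1 / 2) powr (1 / p) / \<theta> * (a * \<omega> n)"
    proof -
      have "((1 / 2) * z powr p) powr (1 / p) = (1 / 2) powr (1 / p) * (z powr p) powr (1 / p)"
        by (rule powr_mult)
      also have "(z powr p) powr (1 / p) = z" using p z by (simp add: powr_powr)
      finally show ?thesis by (simp add: z_def)
    qed
    ultimately show ?thesis
      using False h(3) by (simp add: error_class_norm_def f_def p_def)
  qed
  moreover have "0 < (1 / 2) powr (1 / p) / \<theta>" using \<theta>(1) by simp
  ultimately show ?thesis by blast
qed

text \<open>The bound \<open>1 \<le> C\<close> lets one constant cover the summand
  \<open>N x\<close> as well as the error part.\<close>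

lemma error_class_embeds:
  fixes E E' :: "nat \<Rightarrow> 'a \<Rightarrow> real" and N :: "'a \<Rightarrow> real"
  assumes w: "weight \<omega>" and q: "0 < q" and N: "\<And>x. 0 \<le> N x" and C: "1 \<le> C"
    and E: "\<And>n x. 0 \<le> E' n x" "\<And>n x. 1 \<le> n \<Longrightarrow> E' n x \<le> C * E n x"
  shows "(error_class \<omega> q E, error_class_norm N \<omega> q E) \<hookrightarrow> (error_class \<omega> q E', error_class_norm N \<omega> q E')"
proof -
  have "x \<in> error_class \<omega> q E' \<and> error_class_norm N \<omega> q E' x \<le> C * error_class_norm N \<omega> q E x"
    if x: "x \<in> error_class \<omega> q E" for x
  proof -
    have NC: "N x \<le> C * N x" using mult_right_mono[OF C N[of x]] by simp
    have le: "\<omega> n * E' n x \<le> C * (\<omega> n * E n x)" "0 \<le> \<omega> n * E' n x" if "1 \<le> n" for n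
      using mult_left_mono[OF E(2)[OF that], of "\<omega> n" x] E(1)[of n x] weight_pos[OF w that]
      by (auto simp: algebra_simps)
    show ?thesis
    proof (cases "q = \<infinity>")
      case True
      then have bdd: "bdd_above ((\<lambda>n. \<omega> n * E n x) ` {1..})" using x by (simp add: error_class_def)
      have "\<omega> n * E' n x \<le> C * (SUP n\<in>{1..}. \<omega> n * E n x)" if n: "1 \<le> n" for n
      proof -
        have "\<omega> n * E n x \<le> (SUP n\<in>{1..}. \<omega> n * E n x)" using bdd n by (intro cSUP_upper) auto
        then have "C * (\<omega> n * E n x) \<le> C * (SUP n\<in>{1..}. \<omega> n * E n x)"
          using C by (intro mult_left_mono) auto
        then show ?thesis using le(1)[OF n] by linarith
      qed
      then have "bdd_above ((\<lambda>n. \<omega> n * E' n x) ` {1..})"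
        "(SUP n\<in>{1..}. \<omega> n * E' n x) \<le> C * (SUP n\<in>{1..}. \<omega> n * E n x)"
        by (auto intro!: bdd_aboveI cSUP_least)
      then show ?thesis
        using True NC by (simp add: error_class_def error_class_norm_def distrib_left)
    next
      case False
      define p where "p = enn2real q"
      have p: "0 < p" unfolding p_def using q False by (rule enn2real_pos)
      define f where "f = (\<lambda>n. (\<omega> (Suc n) * E (Suc n) x) powr p * (1 / real (Suc n)))"
      define g where "g = (\<lambda>n. (\<omega> (Suc n) * E' (Suc n) x) powr p * (1 / real (Suc n)))"
      have f: "summable f" using x False by (simp add: error_class_def f_def p_def)
      have gf: "g n \<le> C powr p * f n" for n
      proof -
        have "0 \<le> C * (\<omega> (Suc n) * E (Suc n) x)" using le[of "Suc n"] by simp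
        then have "0 \<le> \<omega> (Suc n) * E (Suc n) x" using C by (simp add: zero_le_mult_iff)
        moreover have "(\<omega> (Suc n) * E' (Suc n) x) powr p \<le> (C * (\<omega> (Suc n) * E (Suc n) x)) powr p"
          using le[of "Suc n"] p by (intro powr_mono2) auto
        ultimately have "(\<omega> (Suc n) * E' (Suc n) x) powr p \<le> C powr p * (\<omega> (Suc n) * E (Suc n) x) powr p"
          using C by (simp add: powr_mult)
        then show ?thesis by (simp add: f_def g_def divide_right_mono)
      qed
      have Cf: "summable (\<lambda>n. C powr p * f n)" using f by (rule summable_mult)
      have g: "summable g"
        by (rule summable_comparison_test[OF _ Cf]) (use gf in \<open>auto simp: g_def\<close>)
      have "suminf g \<le> C powr p * suminf f"
        using suminf_le[OF gf g Cf] suminf_mult[OF f, of "C powr p"] by simp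
      then have "suminf g powr (1 / p) \<le> (C powr p * suminf f) powr (1 / p)"
        using p g by (intro powr_mono2 suminf_nonneg) (auto simp: g_def)
      also have "\<dots> = C * suminf f powr (1 / p)"
        using p C f by (subst powr_mult) (auto simp: powr_powr f_def intro!: suminf_nonneg)
      finally show ?thesis
        using False NC g by (simp add: error_class_def error_class_norm_def f_def g_def p_def distrib_left)
    qed
  qed
  then show ?thesis using C unfolding embeds_def by (intro conjI exI[of _ C]) auto
qed

section \<open>Equivalence of the classes forces superdemocracy\<close>

context M_basis
begin

lemma schauder_bound:
  assumes "schauder scl N e es"
  shows "\<exists>K>0. \<forall>m x. N (partial_sum scl e es m x) \<le> K * N x"
proof -
  define S where "S = (SUP m. op_norm N N (partial_sum scl e es m))"
  have S: "S < \<infinity>" using assms by (simp add: schauder_def S_def)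
  have "N (partial_sum scl e es m x) \<le> (enn2real S + 1) * N x" for m x
  proof (cases "x = 0")
    case True
    then show ?thesis by (simp add: partial_sum_def)
  next
    case False
    then have Nx: "0 < N x" using nonneg[of x] eq_0_iff[of x] by linarith
    define y where "y = scl (of_real (1 / N x)) x"
    have "N y \<le> 1" using Nx by (simp add: y_def homogeneous norm_divide)
    then have "ennreal (N (partial_sum scl e es m y)) \<le> op_norm N N (partial_sum scl e es m)"
      unfolding op_norm_def by (intro SUP_upper) simp
    also have "\<dots> \<le> S" unfolding S_def by (rule SUP_upper) simp
    finally have "N (partial_sum scl e es m y) \<le> enn2real S"
      using S enn2real_mono nonneg by fastforce
    moreover have "partial_sum scl e es m y = scl (of_real (1 / N x)) (partial_sum scl e es m x)"
      by (simp add: partial_sum_def y_def scale_sum_right)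
    ultimately have "N (partial_sum scl e es m x) \<le> enn2real S * N x"
      using Nx by (simp add: homogeneous norm_divide field_simps)
    then show ?thesis using Nx by (simp add: distrib_right)
  qed
  moreover have "0 < enn2real S + 1" by (simp add: add_nonneg_pos)
  ultimately show ?thesis by blast
qed

lemma es_partial_sum: "es j (partial_sum scl e es m x) = (if j < m then es j x else 0)"
  using es_lincomb[of "{..<m}" j "\<lambda>n. es n x"] by (simp add: partial_sum_def del: es_sum)

text \<open>All nonzero coefficients tie, so some greedy ordering exhausts \<open>A\<close> first.
  Any approximant with at most \<open>card A\<close> terms then lives to the left of
  \<open>m\<close>, and removing the partial sum of order \<open>m\<close> from the error leaves
  exactly the block on \<open>B\<close>.\<close>

lemma chebyshev_error_two_blocks:
  assumes K: "\<And>m x. N (partial_sum scl e es m x) \<le> K * N x"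
    and A: "finite A" "A \<subseteq> {..<m}" "unimodular_on A \<epsilon>"
    and B: "finite B" "B \<subseteq> {m..}" "unimodular_on B \<delta>"
    and k: "k \<le> card A"
  shows "N (signed_indicator scl e \<delta> B) \<le> qc * (1 + K) *
    chebyshev_error scl N e es k (signed_indicator scl e \<epsilon> A + signed_indicator scl e \<delta> B)"
proof -
  define x where "x = signed_indicator scl e \<epsilon> A + signed_indicator scl e \<delta> B"
  have disj: "A \<inter> B = {}" using A(2) B(2) by force
  have es_B: "es n (signed_indicator scl e \<delta> B) = (if n \<in> B then \<delta> n else 0)" for n
    unfolding signed_indicator_def using B(1) by (rule es_lincomb)
  have es_x: "es n x = (if n \<in> A then \<epsilon> n else if n \<in> B then \<delta> n else 0)" for n
    using disj A(1) B(1) by (auto simp: x_def signed_indicator_def es_lincomb simp del: es_sum)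
  obtain \<pi> where \<pi>: "\<pi> \<in> greedy_orderings es x" "\<pi> ` {..<card A} = A"
  proof (rule greedy_ordering_of_greedy_set[OF A(1)])
    show "norm (es k x) \<le> norm (es n x)" if "n \<in> A" "k \<notin> A" for n k
      using that A(3) B(3) by (auto simp: es_x unimodular_on_def)
  qed
  have K0: "0 \<le> K * N x" for x using order_trans[OF nonneg K[of 0 x]] .
  have le: "N (signed_indicator scl e \<delta> B) \<le> qc * (1 + K) * N (x - (\<Sum>n<k. scl (a n) (e (\<pi> n))))" for a
  proof -
    define y where "y = x - (\<Sum>n<k. scl (a n) (e (\<pi> n)))"
    have "(y - partial_sum scl e es m y) - signed_indicator scl e \<delta> B = 0"
    proof (rule es_total)
      fix j
      have "es j (\<Sum>n<k. scl (a n) (e (\<pi> n))) = 0" if "\<not> j < m"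
      proof -
        have "j \<noteq> \<pi> n" if "n < k" for n using that \<open>\<not> j < m\<close> \<pi>(2) k A(2) by force
        then show ?thesis by (simp add: biorthogonal)
      qed
      then have "es j y = (if j \<in> B then \<delta> j else 0)" if "\<not> j < m"
        using that A(2) by (auto simp: y_def es_x simp del: es_sum)
      then show "es j ((y - partial_sum scl e es m y) - signed_indicator scl e \<delta> B) = 0"
        using B(2) by (auto simp: es_partial_sum es_B)
    qed
    then have "N (signed_indicator scl e \<delta> B) = N (y - partial_sum scl e es m y)" by simp
    also have "\<dots> \<le> qc * (N y + K * N y)"
      using K[of m y] qc_pos by (intro order_trans[OF N_diff] mult_left_mono add_left_mono) auto
    finally show ?thesis by (simp add: y_def algebra_simps)
  qed
  \<comment> \<open>Testing \<open>K0\<close> on a vector of positive quasi-norm yields the sign of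
    \<open>K\<close>.\<close>
  have "0 \<le> K"
  proof -
    obtain c where "norm (es 0 (e 0)) \<le> c * N (e 0)" using es_bound by blast
    then have "N (e 0) \<noteq> 0" by (auto simp: biorthogonal)
    then have "0 < N (e 0)" using nonneg[of "e 0"] by linarith
    then show ?thesis using K0[of "e 0"] by (simp add: zero_le_mult_iff)
  qed
  then have H: "0 < qc * (1 + K)" using qc_pos by simp
  have "N (signed_indicator scl e \<delta> B) / (qc * (1 + K)) \<le>
      (INF a. N (x - (\<Sum>n<k. scl (a n) (e (\<pi> n)))))"
    using le H by (intro cINF_greatest) (auto simp: divide_le_eq mult.commute)
  also have "\<dots> \<le> chebyshev_error scl N e es k x"
    using \<pi>(1) by (rule chebyshev_inner_le_chebyshev_error)
  finally show ?thesis using H by (simp add: x_def divide_le_eq mult.commute)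
qed

text \<open>The three levels of the error profile, obtained by removing nothing, removing
  \<open>B\<close>, and removing both blocks.\<close>

lemma best_error_two_blocks:
  assumes "finite A" "finite B"
  shows "best_error scl N e k (signed_indicator scl e \<epsilon> A + signed_indicator scl e \<delta> B) \<le>
      qc * (N (signed_indicator scl e \<epsilon> A) + N (signed_indicator scl e \<delta> B))"
    and "card B \<le> k \<Longrightarrow>
      best_error scl N e k (signed_indicator scl e \<epsilon> A + signed_indicator scl e \<delta> B) \<le>
      N (signed_indicator scl e \<epsilon> A)"
    and "A \<inter> B = {} \<Longrightarrow> card A + card B \<le> k \<Longrightarrow>
      best_error scl N e k (signed_indicator scl e \<epsilon> A + signed_indicator scl e \<delta> B) = 0"
proof -
  define x where "x = signed_indicator scl e \<epsilon> A + signed_indicator scl e \<delta> B"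
  have "best_error scl N e k x \<le> N x"
    using best_error_le_subset[of "{}" k x] by simp
  then show "best_error scl N e k (signed_indicator scl e \<epsilon> A + signed_indicator scl e \<delta> B) \<le>
      qc * (N (signed_indicator scl e \<epsilon> A) + N (signed_indicator scl e \<delta> B))"
    using N_add[of "signed_indicator scl e \<epsilon> A" "signed_indicator scl e \<delta> B"] by (simp add: x_def)
  show "best_error scl N e k (signed_indicator scl e \<epsilon> A + signed_indicator scl e \<delta> B) \<le>
      N (signed_indicator scl e \<epsilon> A)" if "card B \<le> k"
    using best_error_le_subset[OF assms(2) that, of x \<delta>] by (simp add: x_def signed_indicator_def)
  show "best_error scl N e k (signed_indicator scl e \<epsilon> A + signed_indicator scl e \<delta> B) = 0"
    if disj: "A \<inter> B = {}" and k: "card A + card B \<le> k"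
  proof -
    define c where "c = (\<lambda>n. if n \<in> A then \<epsilon> n else \<delta> n)"
    have "(\<Sum>n\<in>A \<union> B. scl (c n) (e n)) = (\<Sum>n\<in>A. scl (c n) (e n)) + (\<Sum>n\<in>B. scl (c n) (e n))"
      using assms disj by (rule sum.union_disjoint)
    also have "(\<Sum>n\<in>A. scl (c n) (e n)) = signed_indicator scl e \<epsilon> A"
      by (simp add: c_def signed_indicator_def)
    also have "(\<Sum>n\<in>B. scl (c n) (e n)) = signed_indicator scl e \<delta> B"
      unfolding signed_indicator_def using disj by (intro sum.cong) (auto simp: c_def)
    finally have "best_error scl N e k x \<le> N (x - x)"
      using best_error_le_subset[of "A \<union> B" k x c] assms k
      by (simp add: x_def card_Un_disjoint[OF assms disj])
    then show ?thesis using best_error_nonneg[of k x] by (simp add: x_def)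
  qed
qed

text \<open>Up to constants, and with \<open>s = card B\<close>, \<open>n = card A\<close>, the
  embedding yields \<open>hB * \<omega> n \<le> (hA + hB) * \<omega> s + hA * \<omega> n\<close>.
  After absorption \<open>hB\<close> is controlled by \<open>hA\<close>, and Property (W) bounds the
  upper democracy function at \<open>s\<close> by \<open>hB\<close>.\<close>

lemma superdemocratic_if_embeds:
  assumes w: "doubling_weight \<omega>" and index: "0 < lower_dilation_index \<omega>" and q: "0 < q"
    and schauder: "schauder scl N e es" and W: "property_W scl N e"
    and embeds: "approx_class scl N e \<omega> q \<hookrightarrow> chebyshev_greedy_class scl N e es \<omega> q"
  shows "\<exists>D>0. \<forall>A \<epsilon>. finite A \<longrightarrow> unimodular_on A \<epsilon> \<longrightarrow>
    upper_democracy scl N e (card A) \<le> D * N (signed_indicator scl e \<epsilon> A)"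
proof -
  let ?h = "upper_democracy scl N e" and ?I = "signed_indicator scl e"
  have w': "weight \<omega>" using w by (simp add: doubling_weight_def)
  obtain \<theta> where \<theta>: "1 \<le> \<theta>" "\<And>n. 1 \<le> n \<Longrightarrow> \<omega> (2 * n) \<le> \<theta> * \<omega> n"
    using w unfolding doubling_weight_def by blast
  obtain K where K: "0 < K" "\<And>m x. N (partial_sum scl e es m x) \<le> K * N x"
    using schauder_bound[OF schauder] by blast
  obtain c where c: "0 < c" "\<And>n x. norm (es n x) \<le> c * N x" using es_bound by blast
  obtain V where V: "0 < V" "\<And>n m. 1 \<le> n \<Longrightarrow> n \<le> m \<Longrightarrow> \<exists>A \<epsilon>. A \<subseteq> {m..} \<and> finite A \<and> card A = n \<and>
      unimodular_on A \<epsilon> \<and> ?h n \<le> V * N (?I \<epsilon> A)"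
    using W unfolding property_W_def by blast
  obtain C\<^sub>1 where C\<^sub>1: "0 < C\<^sub>1" "\<And>x s t a b. 1 \<le> s \<Longrightarrow> s \<le> t \<Longrightarrow> 0 \<le> a \<Longrightarrow> 0 \<le> b \<Longrightarrow>
      \<forall>k. 0 \<le> best_error scl N e k x \<Longrightarrow> \<forall>k\<le>s. best_error scl N e k x \<le> a \<Longrightarrow>
      \<forall>k>s. best_error scl N e k x \<le> b \<Longrightarrow> \<forall>k>t. best_error scl N e k x = 0 \<Longrightarrow>
      x \<in> error_class \<omega> q (best_error scl N e) \<and>
      error_class_norm N \<omega> q (best_error scl N e) x \<le> N x + C\<^sub>1 * (a * \<omega> s + b * \<omega> t)"
    using error_class_norm_upper[OF w' index q, of "best_error scl N e" N] by blast
  obtain C\<^sub>2 where C\<^sub>2: "0 < C\<^sub>2" "\<And>x n a. 1 \<le> n \<Longrightarrow> 0 \<le> a \<Longrightarrow> 0 \<le> N x \<Longrightarrow>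
      \<forall>k. 0 \<le> chebyshev_error scl N e es k x \<Longrightarrow>
      \<forall>k\<in>{1..n}. a \<le> chebyshev_error scl N e es k x \<Longrightarrow>
      x \<in> error_class \<omega> q (chebyshev_error scl N e es) \<Longrightarrow>
      C\<^sub>2 * (a * \<omega> n) \<le> error_class_norm N \<omega> q (chebyshev_error scl N e es) x"
    using error_class_norm_lower[OF w q, of N "chebyshev_error scl N e es"] by blast
  obtain C\<^sub>3 where C\<^sub>3: "0 < C\<^sub>3" "\<And>x. x \<in> error_class \<omega> q (best_error scl N e) \<Longrightarrow>
      x \<in> error_class \<omega> q (chebyshev_error scl N e es) \<and>
      error_class_norm N \<omega> q (chebyshev_error scl N e es) x \<le>
        C\<^sub>3 * error_class_norm N \<omega> q (best_error scl N e) x"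
    using embeds unfolding embeds_def approx_class_def chebyshev_greedy_class_def by auto
  define H where "H = qc * (1 + K)"
  have H: "0 < H" using qc_pos K(1) by (simp add: H_def)
  have \<omega>1: "0 < \<omega> 1" using w' by (simp add: weight_def)
  \<comment> \<open>\<open>Z\<close> is the coefficient of \<open>(hA + hB) * \<omega> s\<close>;
    the part \<open>1 / \<omega> 1\<close> comes from trading \<open>N x\<close> for a multiple of
    \<open>\<omega> s\<close>.\<close>
  define Z where "Z = C\<^sub>3 * qc * (1 / \<omega> 1 + C\<^sub>1)"
  have Z: "0 < Z" using C\<^sub>1(1) C\<^sub>3(1) qc_pos \<omega>1 by (simp add: Z_def add_pos_pos)
  \<comment> \<open>This ratio of block sizes makes the \<open>hB\<close> term on the right at most
    half of the left-hand side.\<close>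
  obtain T where T: "1 \<le> T" "\<And>k. 1 \<le> k \<Longrightarrow> (2 * H * Z / C\<^sub>2) * \<omega> k \<le> \<omega> (T * k)"
    using weight_growth[OF w' index] by blast
  define D' where "D' = (Z + C\<^sub>3 * C\<^sub>1 * \<theta>) * (2 * H / C\<^sub>2)"
  have D': "0 < D'" using Z C\<^sub>1(1) C\<^sub>2(1) C\<^sub>3(1) H \<theta>(1) by (simp add: D'_def add_pos_pos)
  \<comment> \<open>Enough doublings to pass from \<open>s\<close> to \<open>n\<close>, because
    \<open>n \<le> 2 * T * s\<close>.\<close>
  obtain i where i: "real (2 * T) < 2 ^ i" using real_arch_pow[of 2 "real (2 * T)"] by auto
  have h0: "0 \<le> ?h n" for n
    using signed_indicator_le_upper_democracy[of "{}" n "\<lambda>_. 1"] nonneg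
    by (simp add: unimodular_on_def signed_indicator_def)
  define D where "D = ?h T * c + (2 * qc) ^ i * (V * D')"
  have D_ge: "?h T * c \<le> D" "(2 * qc) ^ i * (V * D') \<le> D" and D: "0 < D"
    using h0[of T] c(1) V(1) D' qc_pos by (simp_all add: D_def add_nonneg_pos)
  have "?h (card A) \<le> D * N (?I \<epsilon> A)" if A: "finite A" "unimodular_on A \<epsilon>" for A \<epsilon>
  proof -
    define n where "n = card A"
    define hA where "hA = N (?I \<epsilon> A)"
    have hA: "0 \<le> hA" by (simp add: hA_def nonneg)
    consider "n = 0" | "1 \<le> n" "n < T" | "T \<le> n" by linarith
    then have "?h n \<le> D * hA"
    proof cases
      case 1
      have "?h 0 \<le> 0" by (rule upper_democracy_least) (simp add: signed_indicator_def)
      then show ?thesis using 1 D hA by (meson mult_nonneg_nonneg less_imp_le order_trans)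
    next
      \<comment> \<open>For small sets the left-hand side is at most \<open>?h T\<close>, and a
        single coordinate functional bounds \<open>hA\<close> below by \<open>1 / c\<close>.\<close>
      case 2
      then obtain j where j: "j \<in> A" by (auto simp: n_def card_gt_0_iff Suc_le_eq)
      have "norm (es j (?I \<epsilon> A)) = 1"
        unfolding signed_indicator_def es_lincomb[OF A(1)] using j A(2) by (simp add: unimodular_on_def)
      then have "1 \<le> c * hA" using c(2)[of j "?I \<epsilon> A"] by (simp add: hA_def)
      then have "?h T * 1 \<le> ?h T * (c * hA)" using h0 by (rule mult_left_mono)
      moreover have "?h n \<le> ?h T" using 2 by (intro upper_democracy_mono) simp
      moreover have "?h T * c * hA \<le> D * hA" using D_ge(1) hA by (rule mult_right_mono)
      ultimately show ?thesis by simp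
    next
      case 3
      define s where "s = n div T"
      have n1: "1 \<le> n" using 3 T(1) by simp
      have s: "1 \<le> s" "T * s \<le> n" "s \<le> n" "n \<le> 2 * T * s"
      proof -
        show "1 \<le> s" using 3 T(1) by (simp add: s_def Suc_le_eq div_greater_zero_iff)
        show "T * s \<le> n" "s \<le> n" by (simp_all add: s_def)
        have "n < T + T * s"
          using dividend_less_times_div[of T n] T(1) by (simp add: s_def)
        moreover have "T \<le> T * s" using \<open>1 \<le> s\<close> by simp
        ultimately show "n \<le> 2 * T * s" by linarith
      qed
      obtain m' where m': "A \<subseteq> {..<m'}"
        using A(1) finite_nat_set_iff_bounded by (metis lessThan_iff subsetI)
      \<comment> \<open>\<open>m\<close> must lie beyond \<open>A\<close> to separate the blocks,
        and Property (W) requires it to be at least \<open>s\<close>.\<close>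
      define m where "m = max s m'"
      have Am: "A \<subseteq> {..<m}" using m' by (auto simp: m_def)
      obtain B \<delta> where B: "B \<subseteq> {m..}" "finite B" "card B = s" "unimodular_on B \<delta>"
        "?h s \<le> V * N (?I \<delta> B)"
        using V(2)[OF s(1), of m] by (auto simp: m_def)
      define hB where "hB = N (?I \<delta> B)"
      have hB: "0 \<le> hB" by (simp add: hB_def nonneg)
      define x where "x = ?I \<epsilon> A + ?I \<delta> B"
      define a where "a = qc * (hA + hB)"
      have a: "0 \<le> a" using hA hB qc_pos by (simp add: a_def)
      have Nx: "N x \<le> a" unfolding x_def a_def hA_def hB_def by (rule N_add)
      have disj: "A \<inter> B = {}" using Am B(1) by force
      have best: "x \<in> error_class \<omega> q (best_error scl N e)"
        "error_class_norm N \<omega> q (best_error scl N e) x \<le> N x + C\<^sub>1 * (a * \<omega> s + hA * \<omega> (n + s))"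
        using C\<^sub>1(2)[of s "n + s" a hA x] s a hA best_error_nonneg A(1) B(2,3) disj
          best_error_two_blocks[OF A(1) B(2), of _ \<epsilon> \<delta>]
        by (auto simp: x_def a_def hA_def hB_def n_def)
      have cheb: "x \<in> error_class \<omega> q (chebyshev_error scl N e es)"
        "error_class_norm N \<omega> q (chebyshev_error scl N e es) x \<le>
          C\<^sub>3 * error_class_norm N \<omega> q (best_error scl N e) x"
        using C\<^sub>3(2)[OF best(1)] by auto
      have \<omega>s: "0 < \<omega> s" "\<omega> s \<le> \<omega> n" "\<omega> 1 \<le> \<omega> s" and \<omega>n: "0 < \<omega> n"
        using s n1 weight_mono[OF w'] weight_pos[OF w'] by auto
      have \<omega>2n: "\<omega> (n + s) \<le> \<theta> * \<omega> n"
        using weight_mono[OF w', of "n + s" "2 * n"] \<theta>(2)[OF n1] s n1 by simp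
      have "\<forall>k\<in>{1..n}. hB / H \<le> chebyshev_error scl N e es k x"
      proof
        fix k assume "k \<in> {1..n}"
        then have "hB \<le> H * chebyshev_error scl N e es k x"
          unfolding hB_def H_def x_def
          using chebyshev_error_two_blocks[OF K(2) A(1) Am A(2) B(2,1,4)] by (simp add: n_def)
        then show "hB / H \<le> chebyshev_error scl N e es k x" using H by (simp add: divide_le_eq mult.commute)
      qed
      then have "C\<^sub>2 * (hB / H * \<omega> n) \<le> error_class_norm N \<omega> q (chebyshev_error scl N e es) x"
        using n1 hB H nonneg chebyshev_error_nonneg cheb(1) by (intro C\<^sub>2(2)) auto
      also have "\<dots> \<le> C\<^sub>3 * (N x + C\<^sub>1 * (a * \<omega> s + hA * \<omega> (n + s)))"
        using cheb(2) best(2) C\<^sub>3(1) by (meson less_imp_le mult_left_mono order_trans)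
      also have "\<dots> \<le> C\<^sub>3 * (a * (\<omega> s / \<omega> 1) + C\<^sub>1 * (a * \<omega> s + hA * (\<theta> * \<omega> n)))"
      proof (intro mult_left_mono add_mono order_refl)
        have "a * 1 \<le> a * (\<omega> s / \<omega> 1)" using a \<omega>s \<omega>1 by (intro mult_left_mono) auto
        then show "N x \<le> a * (\<omega> s / \<omega> 1)" using Nx by simp
      qed (use C\<^sub>1(1) C\<^sub>3(1) \<omega>2n hA a in auto)
      also have "\<dots> = Z * hA * \<omega> s + hB * (Z * \<omega> s) + C\<^sub>3 * C\<^sub>1 * \<theta> * hA * \<omega> n"
        by (simp add: Z_def a_def algebra_simps)
      \<comment> \<open>The choice of \<open>T\<close> enters here: the \<open>hB\<close> term is
        now exactly half of the left-hand side.\<close>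
      also have "\<dots> \<le> Z * hA * \<omega> n + hB * (C\<^sub>2 / (2 * H) * \<omega> n) + C\<^sub>3 * C\<^sub>1 * \<theta> * hA * \<omega> n"
      proof (intro add_mono mult_left_mono order_refl)
        have "\<omega> (T * s) \<le> \<omega> n" using s T(1) weight_mono[OF w', of "T * s" n] by simp
        then have "(2 * H * Z / C\<^sub>2) * \<omega> s \<le> \<omega> n" using T(2)[OF s(1)] by linarith
        then show "Z * \<omega> s \<le> C\<^sub>2 / (2 * H) * \<omega> n" using C\<^sub>2(1) H by (simp add: field_simps)
      qed (use Z hA hB \<omega>s C\<^sub>1(1) C\<^sub>3(1) \<theta>(1) in auto)
      finally have "C\<^sub>2 * (hB / H * \<omega> n) \<le>
          Z * hA * \<omega> n + hB * (C\<^sub>2 / (2 * H) * \<omega> n) + C\<^sub>3 * C\<^sub>1 * \<theta> * hA * \<omega> n" .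
      moreover have "C\<^sub>2 * (hB / H * \<omega> n) = 2 * (hB * (C\<^sub>2 / (2 * H) * \<omega> n))"
        using H by simp
      ultimately have "hB * (C\<^sub>2 / (2 * H) * \<omega> n) \<le> Z * hA * \<omega> n + C\<^sub>3 * C\<^sub>1 * \<theta> * hA * \<omega> n"
        by linarith
      then have "C\<^sub>2 / (2 * H) * hB * \<omega> n \<le> (Z + C\<^sub>3 * C\<^sub>1 * \<theta>) * hA * \<omega> n"
        by (simp add: algebra_simps)
      then have "C\<^sub>2 / (2 * H) * hB \<le> (Z + C\<^sub>3 * C\<^sub>1 * \<theta>) * hA"
        using \<omega>n by (rule mult_right_le_imp_le)
      then have hBA: "hB \<le> D' * hA" using C\<^sub>2(1) H by (simp add: D'_def field_simps)
      have "n \<le> 2 ^ i * s"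
      proof -
        have "2 * T \<le> 2 ^ i" using i by (metis less_imp_le of_nat_le_iff of_nat_numeral of_nat_power)
        then have "2 * T * s \<le> 2 ^ i * s" by (rule mult_le_mono1)
        then show ?thesis using s(4) by linarith
      qed
      then have "?h n \<le> (2 * qc) ^ i * ?h s"
        using upper_democracy_mono upper_democracy_pow2 order_trans by blast
      also have "\<dots> \<le> (2 * qc) ^ i * (V * (D' * hA))"
        using B(5) hBA V(1) qc_pos unfolding hB_def[symmetric]
        by (intro mult_left_mono) (auto intro: order_trans)
      also have "\<dots> = (2 * qc) ^ i * (V * D') * hA" by simp
      also have "\<dots> \<le> D * hA" using D_ge(2) hA by (rule mult_right_mono)
      finally show ?thesis .
    qed
    then show ?thesis by (simp add: n_def hA_def)
  qed
  then show ?thesis using D by blast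
qed

end

theorem theorem1p3:
  fixes scl :: "'f::{real_normed_field, euclidean_space} \<Rightarrow> 'a::ab_group_add \<Rightarrow> 'a"
    and N :: "'a \<Rightarrow> real"
    and e :: "nat \<Rightarrow> 'a"
    and es :: "nat \<Rightarrow> 'a \<Rightarrow> 'f"
    and \<omega> :: "nat \<Rightarrow> real"
  assumes "doubling_weight \<omega>"
    and "lower_dilation_index \<omega> > 0"
    and "quasi_banach_space scl N"
    and "M_basis scl N e es"
    and "quasi_greedy scl N e es"
  shows "(semi_greedy scl N e es \<longrightarrow>
            (\<forall>q>0. class_equiv (approx_class scl N e \<omega> q) (chebyshev_greedy_class scl N e es \<omega> q)))
       \<and> (schauder scl N e es \<and> property_W scl N e \<and>
            (\<exists>q>0. class_equiv (approx_class scl N e \<omega> q) (chebyshev_greedy_class scl N e es \<omega> q))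
            \<longrightarrow> semi_greedy scl N e es)"
proof -
  interpret M_basis scl N e es by fact
  interpret quasi_greedy_basis scl N e es by unfold_locales fact
  have w: "weight \<omega>" using assms(1) by (simp add: doubling_weight_def)
  have "class_equiv (approx_class scl N e \<omega> q) (chebyshev_greedy_class scl N e es \<omega> q)"
    if semi: "semi_greedy scl N e es" and q: "0 < q" for q
  proof -
    obtain C where C: "0 < C"
      "\<And>x m. 1 \<le> m \<Longrightarrow> chebyshev_error scl N e es m x \<le> C * best_error scl N e m x"
      using semi unfolding semi_greedy_def by blast
    \<comment> \<open>The maximum provides the constant at least 1 that
      \<open>error_class_embeds\<close> requires.\<close>
    have "chebyshev_error scl N e es m x \<le> max 1 C * best_error scl N e m x" if "1 \<le> m" for m x
      using C(2)[OF that] mult_right_mono[OF max.cobounded2 best_error_nonneg] order_trans by blast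
    then have "approx_class scl N e \<omega> q \<hookrightarrow> chebyshev_greedy_class scl N e es \<omega> q"
      unfolding approx_class_def chebyshev_greedy_class_def
      using w q nonneg chebyshev_error_nonneg by (intro error_class_embeds[where C = "max 1 C"]) auto
    moreover have "chebyshev_greedy_class scl N e es \<omega> q \<hookrightarrow> approx_class scl N e \<omega> q"
      unfolding approx_class_def chebyshev_greedy_class_def
      using w q nonneg best_error_nonneg best_error_le_chebyshev_error
      by (intro error_class_embeds[where C = 1]) auto
    ultimately show ?thesis by (simp add: class_equiv_def)
  qed
  moreover have "semi_greedy scl N e es"
    if "schauder scl N e es" "property_W scl N e" "0 < q"
      "class_equiv (approx_class scl N e \<omega> q) (chebyshev_greedy_class scl N e es \<omega> q)" for q
    using superdemocratic_if_embeds[OF assms(1,2) that(3,1,2)] that(4) semi_greedy_if_superdemocratic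
    unfolding class_equiv_def by blast
  ultimately show ?thesis by blast
qed

end
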